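(* Let $\Omega\subset\mathbb{R}^2$ be an axial parallel quadrilateral (an axis-parallel rectangle) with a tensor-product mesh, and let $p\in\{1,2,3\}$. Consider the Galerkin discretization of the Helmholtz problem with Robin boundary conditions with conforming finite elements of polynomial degree $p$ on this mesh. Then, for any $k\in\mathbb{R}\setminus\{0\}$, the system matrix $\mathbf{A}_k$ is regular (invertible).
   Context: Let $\Omega=(x_0,x_M)\times(y_0,y_N)$ and $\Gamma=\partial\Omega$. A tensor-product mesh $\mathcal{K}_{\mathcal{Q}}$ consists of the rectangles $[x_{i-1},x_i]\times[y_{j-1},y_j]$, $1\le i\le M$, $1\le j\le N$, for partitions $x_0<\dots<x_M$ and $y_0<\dots<y_N$. The finite element space $S$ of degree $p$ consists of all continuous complex-valued functions on $\Omega$ whose restriction to each mesh rectangle is a polynomial of degree at most $p$ in each variable. With $(u,v)=\int_\Omega u\overline v$ and $\langle u,v\rangle_\Gamma=\int_\Gamma u\overline v$, set $$a_k(u,v)=(\nabla u,\nabla v)-k^2(u,v)-\mathrm{i}k\langle u,v\rangle_\Gamma .$$ The Galerkin discretization is: find $u_S\in S$ with $a_k(u_S,v)=F(v)$ for all $v\in S$. With $(b_z)_{z\in\Sigma}$ the Lagrange (nodal) basis of $S$, the system matrix is $\mathbf{A}_k=(a_k(b_z,b_y))_{y,z\in\Sigma}$. *)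

theory Defs
  imports "HOL-Analysis.Analysis" "HOL-Computational_Algebra.Polynomial" "Jordan_Normal_Form.Matrix"
begin

(* A partition x 0 < ... < x M of an interval is a sequence x :: nat \<Rightarrow> real together with M;
   only the values x 0, ..., x M matter.  The mesh rectangles are mesh_cell x y i j for
   1 \<le> i \<le> M and 1 \<le> j \<le> N. *)

definition rectangle :: "nat \<Rightarrow> (nat \<Rightarrow> real) \<Rightarrow> nat \<Rightarrow> (nat \<Rightarrow> real) \<Rightarrow> (real \<times> real) set" where
  "rectangle M x N y = {x 0<..<x M} \<times> {y 0<..<y N}"

definition mesh_cell :: "(nat \<Rightarrow> real) \<Rightarrow> (nat \<Rightarrow> real) \<Rightarrow> nat \<Rightarrow> nat \<Rightarrow> (real \<times> real) set" where
  "mesh_cell x y i j = {x (i - 1)..x i} \<times> {y (j - 1)..y j}"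

definition polynomial_on :: "nat \<Rightarrow> (real \<times> real) set \<Rightarrow> (real \<times> real \<Rightarrow> complex) \<Rightarrow> bool" where
  "polynomial_on p K u \<longleftrightarrow> (\<exists>c :: nat \<Rightarrow> nat \<Rightarrow> complex. \<forall>(s, t)\<in>K.
     u (s, t) = (\<Sum>a\<le>p. \<Sum>b\<le>p. c a b * of_real s ^ a * of_real t ^ b))"

(* Elements of S are represented by their continuous extension to the closed rectangle (so that
   they have boundary values), and take the dummy value 0 elsewhere, which makes the
   representation unique. *)
definition fe_space ::
  "nat \<Rightarrow> nat \<Rightarrow> (nat \<Rightarrow> real) \<Rightarrow> nat \<Rightarrow> (nat \<Rightarrow> real) \<Rightarrow> (real \<times> real \<Rightarrow> complex) set" where
  "fe_space p M x N y = {u.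
     continuous_on (closure (rectangle M x N y)) u \<and>
     (\<forall>i\<in>{1..M}. \<forall>j\<in>{1..N}. polynomial_on p (mesh_cell x y i j) u) \<and>
     (\<forall>w. w \<notin> closure (rectangle M x N y) \<longrightarrow> u w = 0)}"

definition node :: "nat \<Rightarrow> (nat \<Rightarrow> real) \<Rightarrow> nat \<Rightarrow> nat \<Rightarrow> real" where
  "node p x i l = x (i - 1) + real l / real p * (x i - x (i - 1))"

definition grid_nodes :: "nat \<Rightarrow> nat \<Rightarrow> (nat \<Rightarrow> real) \<Rightarrow> real set" where
  "grid_nodes p M x = {node p x i l | i l. i \<in> {1..M} \<and> l \<le> p}"

definition fe_nodes :: "nat \<Rightarrow> nat \<Rightarrow> (nat \<Rightarrow> real) \<Rightarrow> nat \<Rightarrow> (nat \<Rightarrow> real) \<Rightarrow> (real \<times> real) set" where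
  "fe_nodes p M x N y = grid_nodes p M x \<times> grid_nodes p N y"

(* Existence and uniqueness are proved below, in lagrange_basis_ex1. *)
definition lagrange_basis ::
  "nat \<Rightarrow> nat \<Rightarrow> (nat \<Rightarrow> real) \<Rightarrow> nat \<Rightarrow> (nat \<Rightarrow> real) \<Rightarrow> real \<times> real \<Rightarrow> real \<times> real \<Rightarrow> complex" where
  "lagrange_basis p M x N y z = (THE u. u \<in> fe_space p M x N y \<and>
     (\<forall>w\<in>fe_nodes p M x N y. u w = (if w = z then 1 else 0)))"

(* Classical partial derivatives.  For elements of S they exist off the mesh lines; the mesh lines
   are a null set, so the (unspecified) values there do not affect the integrals below. *)
definition dx :: "(real \<times> real \<Rightarrow> complex) \<Rightarrow> real \<times> real \<Rightarrow> complex" where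
  "dx u = (\<lambda>(s, t). vector_derivative (\<lambda>r. u (r, t)) (at s))"

definition dy :: "(real \<times> real \<Rightarrow> complex) \<Rightarrow> real \<times> real \<Rightarrow> complex" where
  "dy u = (\<lambda>(s, t). vector_derivative (\<lambda>r. u (s, r)) (at t))"

definition boundary_product ::
  "nat \<Rightarrow> (nat \<Rightarrow> real) \<Rightarrow> nat \<Rightarrow> (nat \<Rightarrow> real) \<Rightarrow>
   (real \<times> real \<Rightarrow> complex) \<Rightarrow> (real \<times> real \<Rightarrow> complex) \<Rightarrow> complex" where
  "boundary_product M x N y u v =
     integral {x 0..x M} (\<lambda>s. u (s, y 0) * cnj (v (s, y 0))) +
     integral {x 0..x M} (\<lambda>s. u (s, y N) * cnj (v (s, y N))) +
     integral {y 0..y N} (\<lambda>t. u (x 0, t) * cnj (v (x 0, t))) +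
     integral {y 0..y N} (\<lambda>t. u (x M, t) * cnj (v (x M, t)))"

definition helmholtz_form ::
  "real \<Rightarrow> nat \<Rightarrow> (nat \<Rightarrow> real) \<Rightarrow> nat \<Rightarrow> (nat \<Rightarrow> real) \<Rightarrow>
   (real \<times> real \<Rightarrow> complex) \<Rightarrow> (real \<times> real \<Rightarrow> complex) \<Rightarrow> complex" where
  "helmholtz_form k M x N y u v =
     integral (rectangle M x N y) (\<lambda>w. dx u w * cnj (dx v w) + dy u w * cnj (dy v w))
     - of_real (k\<^sup>2) * integral (rectangle M x N y) (\<lambda>w. u w * cnj (v w))
     - \<i> * of_real k * boundary_product M x N y u v"

(* The nodes z 0, ..., z (n - 1) are an enumeration of fe_nodes; as in A_k = (a_k(b_z, b_y)) with
   row index y and column index z, the trial function belongs to the column. *)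
definition system_matrix ::
  "real \<Rightarrow> nat \<Rightarrow> nat \<Rightarrow> (nat \<Rightarrow> real) \<Rightarrow> nat \<Rightarrow> (nat \<Rightarrow> real) \<Rightarrow> (nat \<Rightarrow> real \<times> real) \<Rightarrow> complex mat" where
  "system_matrix k p M x N y z =
     (let n = card (fe_nodes p M x N y) in
      mat n n (\<lambda>(r, c). helmholtz_form k M x N y
        (lagrange_basis p M x N y (z c)) (lagrange_basis p M x N y (z r))))"


lemma partition_less:
  fixes x :: "nat \<Rightarrow> real" and M :: nat
  assumes "strict_mono_on {..M} x" "i \<in> {1..M}"
  shows "x (i - 1) < x i"
  using assms by (auto simp: strict_mono_on_def)

lemma partition_le:
  fixes x :: "nat \<Rightarrow> real" and M :: nat
  assumes "strict_mono_on {..M} x" "i \<le> j" "j \<le> M"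
  shows "x i \<le> x j"
  using strict_mono_onD[OF assms(1), of i j] assms by (cases "i = j") auto

lemma closure_rectangle:
  assumes "strict_mono_on {..M} x" "1 \<le> M" "strict_mono_on {..N} y" "1 \<le> N"
  shows "closure (rectangle M x N y) = {x 0..x M} \<times> {y 0..y N}"
proof -
  have "x 0 < x M" "y 0 < y N"
    using assms by (auto simp: strict_mono_on_def)
  then show ?thesis
    unfolding rectangle_def closure_Times by simp
qed

lemma cover_interval:
  fixes x :: "nat \<Rightarrow> real" and M :: nat
  assumes x: "strict_mono_on {..M} x" and M: "1 \<le> M"
  shows "{x 0..x M} = (\<Union>i\<in>{1..M}. {x (i - 1)..x i})"
proof
  show "{x 0..x M} \<subseteq> (\<Union>i\<in>{1..M}. {x (i - 1)..x i})"
  proof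
    fix s assume s: "s \<in> {x 0..x M}"
    define i where "i = (LEAST i. 1 \<le> i \<and> s \<le> x i)"
    have i: "1 \<le> i \<and> s \<le> x i" "i \<le> M"
      using LeastI[of "\<lambda>i. 1 \<le> i \<and> s \<le> x i" M] Least_le[of "\<lambda>i. 1 \<le> i \<and> s \<le> x i" M] s M
      unfolding i_def[symmetric] by simp_all
    have "x (i - 1) \<le> s"
    proof (cases "i = 1")
      case False
      then have "i - 1 < i" "1 \<le> i - 1" using i by auto
      then show ?thesis
        using not_less_Least[of "i - 1" "\<lambda>i. 1 \<le> i \<and> s \<le> x i"] unfolding i_def[symmetric]
        by auto
    qed (use s in auto)
    then show "s \<in> (\<Union>i\<in>{1..M}. {x (i - 1)..x i})" using i by auto
  qed
  show "(\<Union>i\<in>{1..M}. {x (i - 1)..x i}) \<subseteq> {x 0..x M}"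
  proof
    fix s assume "s \<in> (\<Union>i\<in>{1..M}. {x (i - 1)..x i})"
    then obtain i where i: "i \<in> {1..M}" "x (i - 1) \<le> s" "s \<le> x i" by auto
    then have "x 0 \<le> x (i - 1)" "x i \<le> x M"
      by (auto intro!: partition_le[OF x])
    then show "s \<in> {x 0..x M}" using i by auto
  qed
qed

lemma node_inj:
  fixes x :: "nat \<Rightarrow> real" and M :: nat
  assumes "strict_mono_on {..M} x" "i \<in> {1..M}" "1 \<le> p"
  shows "node p x i l = node p x i m \<longleftrightarrow> l = m"
  using partition_less[OF assms(1,2)] assms(3) by (auto simp: node_def)

lemma node_in_cell:
  fixes x :: "nat \<Rightarrow> real" and M :: nat
  assumes "strict_mono_on {..M} x" "i \<in> {1..M}" "1 \<le> p" "l \<le> p"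
  shows "node p x i l \<in> {x (i - 1)..x i}"
proof -
  have "0 \<le> real l / real p" "real l / real p \<le> 1" using assms by auto
  then show ?thesis
    using partition_less[OF assms(1,2)]
    mult_right_mono[of "real l / real p" 1 "x i - x (i - 1)"] by (auto simp: node_def)
qed

lemma finite_grid_nodes: "finite (grid_nodes p M x)"
proof -
  have "grid_nodes p M x = (\<lambda>(i, l). node p x i l) ` ({1..M} \<times> {..p})"
    unfolding grid_nodes_def by fast
  then show ?thesis by simp
qed

lemma finite_fe_nodes: "finite (fe_nodes p M x N y)"
  by (simp add: fe_nodes_def finite_grid_nodes)

lemma poly_vanish:
  fixes d :: "nat \<Rightarrow> complex"
  assumes f: "finite A" and A: "p < card A" and 0: "\<And>s. s \<in> A \<Longrightarrow> (\<Sum>a\<le>p. d a * of_real s ^ a) = 0"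
  shows "a \<le> p \<Longrightarrow> d a = 0"
proof -
  assume a: "a \<le> p"
  define q where "q = (\<Sum>a\<le>p. monom (d a) a)"
  have "q = 0"
  proof (rule ccontr)
    assume q: "q \<noteq> 0"
    have "complex_of_real ` A \<subseteq> {z. poly q z = 0}"
      using 0 by (auto simp: q_def poly_sum poly_monom)
    then have "card A \<le> card {z. poly q z = 0}"
      using card_mono[OF poly_roots_finite[OF q]] card_image[of complex_of_real A]
      by (metis inj_on_def of_real_eq_iff)
    also have "\<dots> \<le> degree q"
      by (rule card_poly_roots_bound[OF q])
    also have "\<dots> \<le> p"
      unfolding q_def by (rule degree_sum_le) (auto intro: order_trans[OF degree_monom_le])
    finally show False using A by simp
  qed
  moreover have "coeff q a = d a"
    using a by (simp add: q_def coeff_sum)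
  ultimately show ?thesis by simp
qed

lemma fe_space_unique:
  assumes p: "1 \<le> p" and x: "strict_mono_on {..M} x" "1 \<le> M" and y: "strict_mono_on {..N} y" "1 \<le> N"
    and u: "u \<in> fe_space p M x N y" and v: "v \<in> fe_space p M x N y"
    and eq: "\<And>w. w \<in> fe_nodes p M x N y \<Longrightarrow> u w = v w"
  shows "u = v"
proof
  fix w :: "real \<times> real"
  obtain s t where w: "w = (s, t)" by (cases w)
  show "u w = v w"
  proof (cases "w \<in> closure (rectangle M x N y)")
    case False
    then show ?thesis using u v by (simp add: fe_space_def w)
  next
    case True
    then have "s \<in> {x 0..x M}" "t \<in> {y 0..y N}"
      by (auto simp: w closure_rectangle[OF x y])
    then obtain i j where ij: "i \<in> {1..M}" "j \<in> {1..N}" "s \<in> {x (i - 1)..x i}" "t \<in> {y (j - 1)..y j}"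
      unfolding cover_interval[OF x] cover_interval[OF y] by blast
    have "polynomial_on p (mesh_cell x y i j) u" "polynomial_on p (mesh_cell x y i j) v"
      using u v ij by (auto simp: fe_space_def)
    then obtain c d where
      c: "\<And>s t. (s, t) \<in> mesh_cell x y i j \<Longrightarrow>
        u (s, t) = (\<Sum>a\<le>p. \<Sum>b\<le>p. c a b * of_real s ^ a * of_real t ^ b)" and
      d: "\<And>s t. (s, t) \<in> mesh_cell x y i j \<Longrightarrow>
        v (s, t) = (\<Sum>a\<le>p. \<Sum>b\<le>p. d a b * of_real s ^ a * of_real t ^ b)"
      unfolding polynomial_on_def by blast
    define e where "e a b = c a b - d a b" for a b
    have e: "u (s, t) - v (s, t) = (\<Sum>a\<le>p. (\<Sum>b\<le>p. e a b * of_real t ^ b) * of_real s ^ a)"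
      if "(s, t) \<in> mesh_cell x y i j" for s t
      unfolding c[OF that] d[OF that] e_def
      by (simp add: sum_subtractf[symmetric] sum_distrib_left left_diff_distrib[symmetric] mult_ac)
    let ?A = "node p x i ` {..p}" and ?B = "node p y j ` {..p}"
    have card: "p < card ?A" "p < card ?B"
      using node_inj[OF x(1) ij(1) p] node_inj[OF y(1) ij(2) p]
      by (auto simp: card_image inj_on_def)
    have cell: "(s, t) \<in> mesh_cell x y i j" "(s, t) \<in> fe_nodes p M x N y" if "s \<in> ?A" "t \<in> ?B" for s t
      using that node_in_cell[OF x(1) ij(1) p] node_in_cell[OF y(1) ij(2) p] ij(1,2)
      unfolding mesh_cell_def fe_nodes_def grid_nodes_def by blast+
    have "(\<Sum>b\<le>p. e a b * of_real t ^ b) = 0" if "t \<in> ?B" "a \<le> p" for t a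
    proof (rule poly_vanish[where A = ?A and d = "\<lambda>a. \<Sum>b\<le>p. e a b * of_real t ^ b"])
      fix s assume s: "s \<in> ?A"
      show "(\<Sum>a\<le>p. (\<Sum>b\<le>p. e a b * of_real t ^ b) * of_real s ^ a) = 0"
        using e[OF cell(1)[OF s that(1)]] eq[OF cell(2)[OF s that(1)]] by simp
    qed (simp_all only: card(1) that(2) finite_imageI finite_atMost)
    then have "e a b = 0" if "a \<le> p" "b \<le> p" for a b
      using that card(2) poly_vanish[where A = ?B and d = "e a" and p = p and a = b]
      by (simp only: finite_imageI finite_atMost)
    then have "u (s, t) - v (s, t) = 0"
      using ij by (subst e) (auto simp: mesh_cell_def)
    then show ?thesis by (simp add: w)
  qed
qed

lemma nodal_function_1d:
  assumes p: "1 \<le> p" and x: "strict_mono_on {..M} x" "1 \<le> M"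
  obtains f :: "real \<Rightarrow> complex" where
    "continuous_on {x 0..x M} f"
    "\<And>i. i \<in> {1..M} \<Longrightarrow> \<exists>d. \<forall>s\<in>{x (i - 1)..x i}. f s = (\<Sum>a\<le>p. d a * of_real s ^ a)"
    "\<And>s. s \<in> grid_nodes p M x \<Longrightarrow> f s = (if s = z then 1 else 0)"
proof -
  define L :: "nat \<Rightarrow> nat \<Rightarrow> real poly" where
    "L i l = (\<Prod>m\<in>{..p} - {l}. Polynomial.smult (1 / (node p x i l - node p x i m)) [:- node p x i m, 1:])" for i l
  define Q where "Q i = (\<Sum>l\<le>p. if node p x i l = z then L i l else 0)" for i
  have L: "poly (L i l) (node p x i m) = (if l = m then 1 else 0)"
    if "i \<in> {1..M}" "m \<le> p" for i l m
  proof (cases "l = m")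
    case True
    have "poly (L i l) (node p x i m) = (\<Prod>n\<in>{..p} - {l}. 1)"
      unfolding L_def poly_prod using True node_inj[OF x(1) that(1) p]
      by (intro prod.cong) (auto simp flip: diff_divide_distrib)
    then show ?thesis using True by simp
  next
    case False
    then show ?thesis using that by (auto simp: L_def poly_prod)
  qed
  have degL: "degree (L i l) \<le> p" if "l \<le> p" for i l
  proof -
    have "degree (Polynomial.smult c [:- r, 1:]) \<le> 1" for c r :: real
      by (rule order_trans[OF degree_smult_le]) simp
    then have "degree (L i l) \<le> (\<Sum>m\<in>{..p} - {l}. 1)"
      unfolding L_def
      by (intro order_trans[OF degree_prod_sum_le] sum_mono) (simp_all only: finite_Diff finite_atMost comp_apply)
    then show ?thesis using that by simp
  qed
  have degQ: "degree (Q i) \<le> p" for i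
    unfolding Q_def by (rule degree_sum_le) (auto simp: degL)
  have Q: "poly (Q i) (node p x i m) = (if node p x i m = z then 1 else 0)"
    if "i \<in> {1..M}" "m \<le> p" for i m
  proof -
    have "poly (Q i) (node p x i m) =
        (\<Sum>l\<le>p. if l = m then (if node p x i l = z then 1 else 0) else 0)"
      unfolding Q_def poly_sum using L[OF that] by (intro sum.cong) auto
    then show ?thesis using that by simp
  qed
  have ends: "node p x i 0 = x (i - 1)" "node p x i p = x i" for i
    using p by (auto simp: node_def)
  define g where "g s = poly (Q (LEAST i. 1 \<le> i \<and> s \<le> x i)) s" for s
  have g: "g s = poly (Q i) s" if i: "i \<in> {1..M}" and s: "s \<in> {x (i - 1)..x i}" for i s
  proof -
    have least: "(LEAST i. 1 \<le> i \<and> s \<le> x i) = j"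
      if j: "1 \<le> j" "j \<le> M" "s \<le> x j" and "j = 1 \<or> x (j - 1) < s" for j
    proof (rule Least_equality)
      fix l assume l: "1 \<le> l \<and> s \<le> x l"
      show "j \<le> l"
      proof (rule ccontr)
        assume "\<not> j \<le> l"
        then have "x l \<le> x (j - 1)" "j \<noteq> 1" using l j by (auto intro!: partition_le[OF x(1)])
        then show False using that l by auto
      qed
    qed (use j in auto)
    show ?thesis
    proof (cases "i = 1 \<or> x (i - 1) < s")
      case True
      then show ?thesis unfolding g_def using least[of i] i s by auto
    next
      case False
      then have s': "s = x (i - 1)" and i1: "i - 1 \<in> {1..M}" "i - 1 \<ge> 1" using s i by auto
      have "(LEAST i. 1 \<le> i \<and> s \<le> x i) = i - 1"
        using i1 partition_less[OF x(1) i1(1)] by (intro least) (auto simp: s')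
      then have "g s = poly (Q (i - 1)) (node p x (i - 1) p)" by (simp add: g_def s' ends)
      also have "\<dots> = poly (Q i) (node p x i 0)"
        using Q[OF i1(1), of p] Q[OF i, of 0] by (simp add: ends)
      finally show ?thesis by (simp add: s' ends)
    qed
  qed
  show ?thesis
  proof (rule that[of "\<lambda>s. of_real (g s)"])
    have "continuous_on {x (i - 1)..x i} g" if "i \<in> {1..M}" for i
      by (rule continuous_on_eq[of _ "poly (Q i)"]) (auto intro!: continuous_intros simp: g[OF that])
    then have "continuous_on {x 0..x M} g"
      unfolding cover_interval[OF x] by (intro continuous_on_closed_Union) auto
    then show "continuous_on {x 0..x M} (\<lambda>s. complex_of_real (g s))"
      by (rule continuous_on_of_real)
  next
    fix i assume i: "i \<in> {1..M}"
    have "poly (Q i) s = (\<Sum>a\<le>p. coeff (Q i) a * s ^ a)" for s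
      unfolding poly_altdef using degQ[of i]
      by (intro sum.mono_neutral_left) (auto simp: coeff_eq_0)
    then show "\<exists>d. \<forall>s\<in>{x (i - 1)..x i}. complex_of_real (g s) = (\<Sum>a\<le>p. d a * of_real s ^ a)"
      using g[OF i] by (intro exI[of _ "\<lambda>a. of_real (coeff (Q i) a)"]) auto
  next
    fix s assume "s \<in> grid_nodes p M x"
    then obtain i l where il: "i \<in> {1..M}" "l \<le> p" "s = node p x i l"
      by (auto simp: grid_nodes_def)
    then show "complex_of_real (g s) = (if s = z then 1 else 0)"
      using g[OF il(1), of s] node_in_cell[OF x(1) il(1) p il(2)] Q[OF il(1,2)] by auto
  qed
qed

lemma lagrange_basis_ex1:
  assumes p: "1 \<le> p" and x: "strict_mono_on {..M} x" "1 \<le> M" and y: "strict_mono_on {..N} y" "1 \<le> N"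
  shows "\<exists>!u. u \<in> fe_space p M x N y \<and>
    (\<forall>w\<in>fe_nodes p M x N y. u w = (if w = z then 1 else 0))"
proof -
  obtain z1 z2 where z: "z = (z1, z2)" by (cases z)
  obtain f where f: "continuous_on {x 0..x M} f"
    "\<And>i. i \<in> {1..M} \<Longrightarrow> \<exists>d. \<forall>s\<in>{x (i - 1)..x i}. f s = (\<Sum>a\<le>p. d a * of_real s ^ a)"
    "\<And>s. s \<in> grid_nodes p M x \<Longrightarrow> f s = (if s = z1 then 1 else (0 :: complex))"
    using nodal_function_1d[OF p x] by blast
  obtain g where g: "continuous_on {y 0..y N} g"
    "\<And>j. j \<in> {1..N} \<Longrightarrow> \<exists>d. \<forall>t\<in>{y (j - 1)..y j}. g t = (\<Sum>a\<le>p. d a * of_real t ^ a)"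
    "\<And>t. t \<in> grid_nodes p N y \<Longrightarrow> g t = (if t = z2 then 1 else (0 :: complex))"
    using nodal_function_1d[OF p y] by blast
  define R where "R = {x 0..x M} \<times> {y 0..y N}"
  define u where "u w = (if w \<in> R then f (fst w) * g (snd w) else 0)" for w
  have clo: "closure (rectangle M x N y) = R"
    by (simp add: R_def closure_rectangle[OF x y])
  have cells: "mesh_cell x y i j \<subseteq> R" if "i \<in> {1..M}" "j \<in> {1..N}" for i j
    using that unfolding R_def mesh_cell_def cover_interval[OF x] cover_interval[OF y] by blast
  have nodes: "fe_nodes p M x N y \<subseteq> R"
    unfolding R_def fe_nodes_def grid_nodes_def cover_interval[OF x] cover_interval[OF y]
    using node_in_cell[OF x(1) _ p] node_in_cell[OF y(1) _ p] by blast
  have "continuous_on R (\<lambda>w. f (fst w) * g (snd w))"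
    unfolding R_def
    by (intro continuous_on_mult continuous_on_compose2[OF f(1)] continuous_on_compose2[OF g(1)]
        continuous_intros) auto
  then have cont: "continuous_on R u"
    by (rule continuous_on_eq) (simp add: u_def)
  have pol: "polynomial_on p (mesh_cell x y i j) u" if ij: "i \<in> {1..M}" "j \<in> {1..N}" for i j
  proof -
    obtain d e where
      d: "\<And>s. s \<in> {x (i - 1)..x i} \<Longrightarrow> f s = (\<Sum>a\<le>p. d a * of_real s ^ a)" and
      e: "\<And>t. t \<in> {y (j - 1)..y j} \<Longrightarrow> g t = (\<Sum>a\<le>p. e a * of_real t ^ a)"
      using f(2)[OF ij(1)] g(2)[OF ij(2)] by blast
    have "u (s, t) = (\<Sum>a\<le>p. \<Sum>b\<le>p. d a * e b * of_real s ^ a * of_real t ^ b)"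
      if "(s, t) \<in> mesh_cell x y i j" for s t
    proof -
      have "u (s, t) = f s * g t" using that cells[OF ij] by (auto simp: u_def)
      also have "\<dots> = (\<Sum>a\<le>p. d a * of_real s ^ a) * (\<Sum>b\<le>p. e b * of_real t ^ b)"
        using that d[of s] e[of t] by (simp add: mesh_cell_def)
      finally show ?thesis by (simp add: sum_product algebra_simps)
    qed
    then show ?thesis
      unfolding polynomial_on_def by (intro exI[of _ "\<lambda>a b. d a * e b"]) auto
  qed
  have val: "u w = (if w = z then 1 else 0)" if "w \<in> fe_nodes p M x N y" for w
  proof -
    obtain s t where st: "w = (s, t)" "s \<in> grid_nodes p M x" "t \<in> grid_nodes p N y"
      using \<open>w \<in> _\<close> by (auto simp: fe_nodes_def)
    have "u w = f s * g t"
      using \<open>w \<in> _\<close> nodes by (auto simp: u_def st(1))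
    then show ?thesis
      using f(3)[OF st(2)] g(3)[OF st(3)] by (simp add: st(1) z)
  qed
  have "u \<in> fe_space p M x N y"
    using cont pol by (auto simp: fe_space_def clo u_def)
  then show ?thesis
    using val fe_space_unique[OF p x y] by (intro ex1I[of _ u]) auto
qed

end

theory Submission
  imports Defs "Jordan_Normal_Form.Schur_Decomposition"
begin

text \<open>It suffices to show that the system matrix has trivial kernel, that is, that a finite element
function \<open>u\<close> with \<open>a\<^sub>k(u,v) = 0\<close> for all \<open>v\<close> vanishes.  Testing with \<open>v = u\<close> and taking the
imaginary part kills the boundary integral of \<open>|u|\<^sup>2\<close>, since the volume terms are real; hence
\<open>u = 0\<close> on \<open>\<Gamma>\<close>.  What remains is a unique continuation property of the volume form, which
separation of variables reduces to one dimension.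

Since the mesh is a tensor product, \<open>u(s,t) = \<Sum>b. U\<^sub>b(s) L\<^sub>b(t)\<close> with the nodal basis functions
\<open>L\<^sub>b\<close> in the second variable and piecewise polynomials \<open>U\<^sub>b\<close> in the first that vanish at \<open>x 0\<close>
(boundary condition).  With the one-dimensional stiffness and mass forms \<open>A\<close> and \<open>M\<close>, testing with
\<open>\<eta> \<otimes> L\<^sub>c\<close> gives
\<open>\<Sum>b. A(U\<^sub>b,\<eta>) M(L\<^sub>b,L\<^sub>c) = \<Sum>b. M(U\<^sub>b,\<eta>) (k\<^sup>2 M(L\<^sub>b,L\<^sub>c) - A(L\<^sub>b,L\<^sub>c))\<close> for all \<open>\<eta>\<close> and \<open>c\<close>.
The Gram matrix of the \<open>L\<^sub>b\<close> is invertible, so this reads \<open>A(U\<^sub>b,\<eta>) = \<Sum>c. G\<^sub>b\<^sub>c M(U\<^sub>c,\<eta>)\<close> with a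
complex matrix \<open>G\<close>.  A Schur triangularization of \<open>G\<close> turns the \<open>U\<^sub>b\<close> into combinations \<open>w\<close> that,
taken one after the other, satisfy \<open>A(w,\<eta>) = l M(w,\<eta>)\<close> for all \<open>\<eta>\<close>, and \<open>w(x 0) = 0\<close>
(\<open>pencil_zero\<close>).  So only the following is left: a one-dimensional discrete eigenfunction of the
full (Neumann) space that vanishes at the left end point is zero
(\<open>discrete_unique_continuation\<close>).

Taking \<open>\<eta> = w\<close> shows that \<open>l\<close> is real and nonnegative.  One then proceeds from cell to cell: if \<open>w\<close>
vanishes to the left of the cell \<open>[a,b]\<close>, test with the function that is constant left of the cell,
\<open>(b - s) w'(s)\<close> on the cell, and zero to its right.  The polynomial degree of this function does not exceed that
of \<open>w\<close>, so it is admissible, and it yields a Rellich identity in which all terms have one sign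
(\<open>rellich_cell\<close>).\<close>

section \<open>The Rellich identity on one cell\<close>

lemma poly_of_real_has_vector_derivative:
  "((\<lambda>s. poly q (complex_of_real s)) has_vector_derivative poly (pderiv q) (complex_of_real s)) (at s within S)"
  by (rule has_vector_derivative_real_field) (rule poly_DERIV)

definition cell_ip :: "real \<Rightarrow> real \<Rightarrow> complex poly \<Rightarrow> complex poly \<Rightarrow> complex" where
  "cell_ip a b q r = integral {a..b} (\<lambda>s. poly q (of_real s) * cnj (poly r (of_real s)))"

lemma continuous_on_poly_of_real:
  "continuous_on S (\<lambda>s. poly q (complex_of_real s))"
  by (intro continuous_intros)

lemma cell_ip_integrable: "(\<lambda>s. poly q (complex_of_real s) * cnj (poly r (complex_of_real s))) integrable_on {a..b}"
  by (intro integrable_continuous_real continuous_intros)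

lemma cell_ip_sum_left:
  assumes "finite I"
  shows "cell_ip a b (\<Sum>c\<in>I. Polynomial.smult (\<alpha> c) (q c)) r = (\<Sum>c\<in>I. \<alpha> c * cell_ip a b (q c) r)"
proof -
  have "cell_ip a b (\<Sum>c\<in>I. Polynomial.smult (\<alpha> c) (q c)) r =
      integral {a..b} (\<lambda>s. \<Sum>c\<in>I. \<alpha> c * (poly (q c) (of_real s) * cnj (poly r (of_real s))))"
    unfolding cell_ip_def by (simp add: poly_sum sum_distrib_right mult.assoc)
  also have "\<dots> = (\<Sum>c\<in>I. \<alpha> c * cell_ip a b (q c) r)"
    unfolding cell_ip_def
    by (subst integral_sum)
      (simp_all add: assms integrable_on_mult_right cell_ip_integrable)
  finally show ?thesis .
qed

lemma cell_ip_cnj: "cell_ip a b r q = cnj (cell_ip a b q r)"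
  unfolding cell_ip_def by (simp add: integral_cnj mult.commute)

lemma cell_ip_0_left [simp]: "cell_ip a b 0 r = 0" and cell_ip_0_right [simp]: "cell_ip a b r 0 = 0"
  by (simp_all add: cell_ip_def)

lemma cell_ip_self: "cell_ip a b q q = of_real (integral {a..b} (\<lambda>s. (cmod (poly q (of_real s)))\<^sup>2))"
proof -
  have "((\<lambda>s. (cmod (poly q (of_real s)))\<^sup>2) has_integral
      integral {a..b} (\<lambda>s. (cmod (poly q (of_real s)))\<^sup>2)) {a..b}"
    by (intro integrable_integral integrable_continuous_real continuous_intros)
  from has_integral_linear[OF this bounded_linear_of_real[where 'a = complex]]
  show ?thesis unfolding cell_ip_def
    by (intro integral_unique) (simp add: complex_norm_square[symmetric] o_def)
qed

lemma poly_eq_0_if_zero_on_interval: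
  assumes "a < b" and "\<And>s. s \<in> {a..b} \<Longrightarrow> poly q (complex_of_real s) = 0"
  shows "q = 0"
proof (rule ccontr)
  assume "q \<noteq> 0"
  then have "finite {w. poly q w = 0}" by (rule poly_roots_finite)
  moreover have "complex_of_real ` {a..b} \<subseteq> {w. poly q w = 0}" using assms(2) by auto
  ultimately have "finite (complex_of_real ` {a..b})" by (rule rev_finite_subset)
  then have "finite {a..b}" by (rule finite_imageD) (auto simp: inj_on_def)
  then show False using assms(1) infinite_Icc by blast
qed

lemma cell_ip_self_eq_0:
  assumes "a < b" and "cell_ip a b q q = 0"
  shows "q = 0"
proof (rule poly_eq_0_if_zero_on_interval[OF assms(1)])
  fix s assume s: "s \<in> {a..b}"
  have "integral {a..b} (\<lambda>s. (cmod (poly q (of_real s)))\<^sup>2) = 0"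
    using assms(2) unfolding cell_ip_self by simp
  moreover have "continuous_on {a..b} (\<lambda>s. (cmod (poly q (of_real s)))\<^sup>2)"
    by (intro continuous_intros)
  ultimately have "(cmod (poly q (of_real s)))\<^sup>2 = 0"
    using integral_eq_0_iff[of a b "\<lambda>s. (cmod (poly q (of_real s)))\<^sup>2"] s assms(1) by simp
  then show "poly q (of_real s) = 0" by simp
qed

text \<open>Discrete Rellich identity.  With \<open>g = (b - s) q'\<close>, integrating \<open>2 Re (q' cnj g' - l q cnj g)\<close> over
\<open>[a, b]\<close> by parts gives, since \<open>q a = 0\<close>, the value
\<open>- (b - a) |q' a|\<^sup>2\<close> minus the integral of \<open>|q'|\<^sup>2 + l |q|\<^sup>2\<close>.  All these contributions have the
same sign for \<open>l \<ge> 0\<close>, so each of them vanishes.\<close>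

lemma rellich_cell:
  fixes q :: "complex poly" and a b l :: real
  assumes ab: "a < b" and qa: "poly q (of_real a) = 0" and l: "0 \<le> l"
    and eq: "cell_ip a b (pderiv q) (pderiv ([:of_real b, -1:] * pderiv q)) =
      of_real l * cell_ip a b q ([:of_real b, -1:] * pderiv q)"
  shows "q = 0"
proof -
  define Q where "Q s = poly q (complex_of_real s)" for s
  define D where "D s = poly (pderiv q) (complex_of_real s)" for s
  define D2 where "D2 s = poly (pderiv (pderiv q)) (complex_of_real s)" for s
  have dQ: "(Q has_vector_derivative D s) (at s within S)"
    and dD: "(D has_vector_derivative D2 s) (at s within S)" for s S
    unfolding Q_def D_def D2_def by (rule poly_of_real_has_vector_derivative)+
  \<comment> \<open>The boundary term of the integration by parts; \<open>\<phi> / 2\<close> is its derivative.\<close>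
  define \<Phi> where "\<Phi> s = (b - s) * ((D s \<bullet> D s) - l * (Q s \<bullet> Q s)) / 2" for s
  define \<phi> where "\<phi> s = - (D s \<bullet> D s) + l * (Q s \<bullet> Q s) + 2 * (b - s) * (D s \<bullet> D2 s - l * (Q s \<bullet> D s))" for s
  have dDD: "((\<lambda>s. D s \<bullet> D s) has_real_derivative 2 * (D s \<bullet> D2 s)) (at s within {a..b})"
    and dQQ: "((\<lambda>s. Q s \<bullet> Q s) has_real_derivative 2 * (Q s \<bullet> D s)) (at s within {a..b})" for s
    using bounded_bilinear.has_vector_derivative[OF bounded_bilinear_inner dD dD, of s "{a..b}"]
      bounded_bilinear.has_vector_derivative[OF bounded_bilinear_inner dQ dQ, of s "{a..b}"]
    by (simp_all add: has_real_derivative_iff_has_vector_derivative inner_commute)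
  have "(\<Phi> has_vector_derivative (\<phi> s / 2)) (at s within {a..b})" for s
    unfolding \<Phi>_def \<phi>_def has_real_derivative_iff_has_vector_derivative[symmetric]
    by (rule derivative_eq_intros dDD dQQ refl)+ (simp, simp add: field_simps)
  then have "((\<lambda>s. \<phi> s / 2) has_integral (\<Phi> b - \<Phi> a)) {a..b}"
    using ab by (intro fundamental_theorem_of_calculus) auto
  moreover have "\<Phi> b = 0" "\<Phi> a = (b - a) * (D a \<bullet> D a) / 2"
    using qa by (simp_all add: \<Phi>_def Q_def)
  ultimately have ftc: "((\<lambda>s. \<phi> s / 2) has_integral - ((b - a) * (D a \<bullet> D a) / 2)) {a..b}" by simp
  define F where "F s = D s * cnj (poly (pderiv ([:of_real b, -1:] * pderiv q)) (of_real s))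
      - of_real l * (Q s * cnj (poly ([:of_real b, -1:] * pderiv q) (of_real s)))" for s
  have "(F has_integral (cell_ip a b (pderiv q) (pderiv ([:of_real b, -1:] * pderiv q)) -
      of_real l * cell_ip a b q ([:of_real b, -1:] * pderiv q))) {a..b}"
    unfolding F_def cell_ip_def Q_def D_def
    by (intro has_integral_diff has_integral_mult_right integrable_integral cell_ip_integrable)
  then have "(F has_integral 0) {a..b}" using eq by simp
  from has_integral_linear[OF this bounded_linear_Re]
  have "((\<lambda>s. Re (F s)) has_integral 0) {a..b}" by (simp add: o_def)
  moreover have "Re (F s) = \<phi> s / 2 - (D s \<bullet> D s + l * (Q s \<bullet> Q s)) / 2" for s
  proof -
    have e1: "poly ([:of_real b, -1:] * pderiv q) (of_real s) = of_real (b - s) * D s"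
      by (simp add: D_def algebra_simps)
    have "pderiv [:complex_of_real b, -1:] = [:-1:]"
      by (simp add: pderiv_pCons)
    then have e2: "poly (pderiv ([:of_real b, -1:] * pderiv q)) (of_real s) = of_real (b - s) * D2 s - D s"
      unfolding pderiv_mult by (simp add: D_def D2_def algebra_simps)
    show ?thesis
      unfolding F_def e1 e2 \<phi>_def inner_complex_def by (simp add: field_simps)
  qed
  ultimately have "((\<lambda>s. \<phi> s / 2 - (D s \<bullet> D s + l * (Q s \<bullet> Q s)) / 2) has_integral 0) {a..b}" by simp
  from has_integral_diff[OF ftc this]
  have e: "((\<lambda>s. (D s \<bullet> D s + l * (Q s \<bullet> Q s)) / 2) has_integral - ((b - a) * (D a \<bullet> D a) / 2)) {a..b}"
    by simp
  have cont: "continuous_on {a..b} D"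
    unfolding D_def by (rule continuous_on_poly_of_real)
  have i: "(\<lambda>s. (cmod (D s))\<^sup>2 / 2) integrable_on {a..b}"
    by (intro integrable_continuous_real continuous_intros cont) auto
  have "integral {a..b} (\<lambda>s. (cmod (D s))\<^sup>2 / 2) \<le> - ((b - a) * (D a \<bullet> D a) / 2)"
    by (rule has_integral_le[OF integrable_integral[OF i] e])
      (use l in \<open>auto simp: power2_norm_eq_inner intro!: divide_right_mono\<close>)
  also have "\<dots> \<le> 0" using ab by simp
  finally have "integral {a..b} (\<lambda>s. (cmod (D s))\<^sup>2) \<le> 0" by simp
  moreover have "0 \<le> integral {a..b} (\<lambda>s. (cmod (D s))\<^sup>2)"
    by (intro Henstock_Kurzweil_Integration.integral_nonneg integrable_continuous_real continuous_intros cont) auto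
  ultimately have "cell_ip a b (pderiv q) (pderiv q) = 0"
    by (simp add: cell_ip_self D_def)
  then have "pderiv q = 0" using cell_ip_self_eq_0[OF ab] by blast
  then obtain c where "q = [:c:]" using pderiv_iszero by blast
  then show ?thesis using qa by simp
qed

section \<open>Piecewise polynomials on a partition\<close>

text \<open>A piecewise polynomial is encoded by the family of its polynomials, where \<open>Q i\<close> lives on the cell
\<open>[x (i - 1), x i]\<close>.  On such families differentiation and linear combinations are purely algebraic,
with no exceptional points at the breakpoints.\<close>

definition mass :: "nat \<Rightarrow> (nat \<Rightarrow> real) \<Rightarrow> (nat \<Rightarrow> complex poly) \<Rightarrow> (nat \<Rightarrow> complex poly) \<Rightarrow> complex" where
  "mass M x Q R = (\<Sum>i=1..M. cell_ip (x (i - 1)) (x i) (Q i) (R i))"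

definition stiff :: "nat \<Rightarrow> (nat \<Rightarrow> real) \<Rightarrow> (nat \<Rightarrow> complex poly) \<Rightarrow> (nat \<Rightarrow> complex poly) \<Rightarrow> complex" where
  "stiff M x Q R = mass M x (\<lambda>i. pderiv (Q i)) (\<lambda>i. pderiv (R i))"

lemma mass_sum_left:
  assumes "finite I"
  shows "mass M x (\<lambda>i. \<Sum>c\<in>I. Polynomial.smult (\<alpha> c) (Q c i)) R = (\<Sum>c\<in>I. \<alpha> c * mass M x (Q c) R)"
  unfolding mass_def cell_ip_sum_left[OF assms] sum_distrib_left by (rule sum.swap)

lemma mass_cnj: "mass M x R Q = cnj (mass M x Q R)"
  unfolding mass_def by (subst cell_ip_cnj) simp

lemma mass_sum_right:
  assumes "finite I"
  shows "mass M x R (\<lambda>i. \<Sum>c\<in>I. Polynomial.smult (\<alpha> c) (Q c i)) = (\<Sum>c\<in>I. cnj (\<alpha> c) * mass M x R (Q c))"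
  by (subst mass_cnj, subst mass_sum_left[OF assms], subst (2) mass_cnj) simp

lemma pderiv_sum_smult:
  "pderiv (\<Sum>c\<in>I. Polynomial.smult (\<alpha> c) (q c)) = (\<Sum>c\<in>I. Polynomial.smult (\<alpha> c) (pderiv (q c)))"
  by (simp add: higher_pderiv_sum[of 1, simplified] pderiv_smult)

lemma stiff_sum_left:
  assumes "finite I"
  shows "stiff M x (\<lambda>i. \<Sum>c\<in>I. Polynomial.smult (\<alpha> c) (Q c i)) R = (\<Sum>c\<in>I. \<alpha> c * stiff M x (Q c) R)"
  unfolding stiff_def pderiv_sum_smult by (rule mass_sum_left[OF assms])

lemma stiff_sum_right:
  assumes "finite I"
  shows "stiff M x R (\<lambda>i. \<Sum>c\<in>I. Polynomial.smult (\<alpha> c) (Q c i)) = (\<Sum>c\<in>I. cnj (\<alpha> c) * stiff M x R (Q c))"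
  unfolding stiff_def pderiv_sum_smult by (rule mass_sum_right[OF assms])

lemma stiff_cnj: "stiff M x R Q = cnj (stiff M x Q R)"
  unfolding stiff_def by (rule mass_cnj)

lemma mass_cong:
  assumes "\<And>i. i \<in> {1..M} \<Longrightarrow> Q i = Q' i" "\<And>i. i \<in> {1..M} \<Longrightarrow> R i = R' i"
  shows "mass M x Q R = mass M x Q' R'"
  unfolding mass_def using assms by (intro sum.cong) auto

lemma stiff_cong:
  assumes "\<And>i. i \<in> {1..M} \<Longrightarrow> Q i = Q' i" "\<And>i. i \<in> {1..M} \<Longrightarrow> R i = R' i"
  shows "stiff M x Q R = stiff M x Q' R'"
  unfolding stiff_def using assms by (intro mass_cong) auto

lemma mass_self_nonneg: "\<exists>r\<ge>0. mass M x Q Q = of_real r"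
proof -
  have "0 \<le> integral {a..b} (\<lambda>s. (cmod (poly q (of_real s)))\<^sup>2)" for a b and q :: "complex poly"
    by (intro Henstock_Kurzweil_Integration.integral_nonneg integrable_continuous_real continuous_intros) auto
  then show ?thesis
    unfolding mass_def cell_ip_self of_real_sum[symmetric]
    by (intro exI[of _ "\<Sum>i=1..M. integral {x (i - 1)..x i} (\<lambda>s. (cmod (poly (Q i) (of_real s)))\<^sup>2)"]
        conjI sum_nonneg refl)
qed

lemma mass_self_eq_0:
  assumes x: "strict_mono_on {..M} x" and 0: "mass M x Q Q = 0" and i: "i \<in> {1..M}"
  shows "Q i = 0"
proof -
  have nn: "0 \<le> integral {a..b} (\<lambda>s. (cmod (poly q (of_real s)))\<^sup>2)" for a b and q :: "complex poly"
    by (intro Henstock_Kurzweil_Integration.integral_nonneg integrable_continuous_real continuous_intros) auto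
  have "(\<Sum>i=1..M. integral {x (i - 1)..x i} (\<lambda>s. (cmod (poly (Q i) (of_real s)))\<^sup>2)) = 0"
    using 0 by (simp only: mass_def cell_ip_self of_real_sum[symmetric] of_real_eq_0_iff)
  then have "cell_ip (x (i - 1)) (x i) (Q i) (Q i) = 0"
    using i nn unfolding cell_ip_self by (subst (asm) sum_nonneg_eq_0_iff) auto
  then show ?thesis using cell_ip_self_eq_0 partition_less[OF x i] by blast
qed

text \<open>Read from right to left, this recognizes a sum over index pairs as a squared norm; the boundary
term of the energy identity is treated in this way.\<close>

lemma mass_double_sum:
  assumes "finite I"
  shows "mass M x (\<lambda>i. \<Sum>b\<in>I. Polynomial.smult (\<phi> b) (F b i)) (\<lambda>i. \<Sum>b\<in>I. Polynomial.smult (\<phi> b) (F b i)) =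
    (\<Sum>b'\<in>I. \<Sum>b\<in>I. mass M x (F b) (F b') * (\<phi> b * cnj (\<phi> b')))"
  unfolding mass_sum_left[OF assms] mass_sum_right[OF assms] sum_distrib_left
  by (subst sum.swap) (simp add: mult_ac)

lemma mass_0_left: "(\<And>i. i \<in> {1..M} \<Longrightarrow> Q i = 0) \<Longrightarrow> mass M x Q R = 0"
  by (simp add: mass_def)

text \<open>The \<open>L\<^sup>2\<close> product on the boundary of the interval, which consists of two points.\<close>

definition trace_form :: "nat \<Rightarrow> (nat \<Rightarrow> real) \<Rightarrow> (nat \<Rightarrow> complex poly) \<Rightarrow> (nat \<Rightarrow> complex poly) \<Rightarrow> complex" where
  "trace_form M x Q R = poly (Q 1) (of_real (x 0)) * cnj (poly (R 1) (of_real (x 0))) +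
     poly (Q M) (of_real (x M)) * cnj (poly (R M) (of_real (x M)))"

lemma trace_form_sum_left:
  "trace_form M x (\<lambda>i. \<Sum>c\<in>I. Polynomial.smult (\<alpha> c) (Q c i)) R = (\<Sum>c\<in>I. \<alpha> c * trace_form M x (Q c) R)"
  by (simp add: trace_form_def poly_sum sum_distrib_left sum_distrib_right sum.distrib algebra_simps)

lemma trace_form_cnj: "trace_form M x R Q = cnj (trace_form M x Q R)"
  by (simp add: trace_form_def mult.commute)

lemma trace_form_cong:
  assumes "1 \<le> M" "\<And>i. i \<in> {1..M} \<Longrightarrow> Q i = Q' i" "\<And>i. i \<in> {1..M} \<Longrightarrow> R i = R' i"
  shows "trace_form M x Q R = trace_form M x Q' R'"
  using assms(1) assms(2)[of 1] assms(2)[of M] assms(3)[of 1] assms(3)[of M] by (simp add: trace_form_def)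

lemma trace_form_sum_right:
  "trace_form M x R (\<lambda>i. \<Sum>c\<in>I. Polynomial.smult (\<alpha> c) (Q c i)) = (\<Sum>c\<in>I. cnj (\<alpha> c) * trace_form M x R (Q c))"
  by (subst trace_form_cnj, subst trace_form_sum_left, subst (2) trace_form_cnj) simp

text \<open>The one-dimensional finite element space: the second clause is continuity at the interior
breakpoints.\<close>

definition pw_space :: "nat \<Rightarrow> nat \<Rightarrow> (nat \<Rightarrow> real) \<Rightarrow> (nat \<Rightarrow> complex poly) set" where
  "pw_space p M x = {Q. (\<forall>i\<in>{1..M}. degree (Q i) \<le> p) \<and>
     (\<forall>i\<in>{1..<M}. poly (Q i) (of_real (x i)) = poly (Q (Suc i)) (of_real (x i)))}"

lemma pw_space_sum:
  assumes "finite I" "\<And>c. c \<in> I \<Longrightarrow> Q c \<in> pw_space p M x"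
  shows "(\<lambda>i. \<Sum>c\<in>I. Polynomial.smult (\<alpha> c) (Q c i)) \<in> pw_space p M x"
  using assms unfolding pw_space_def
  by (auto simp: poly_sum intro!: degree_sum_le order_trans[OF degree_smult_le] sum.cong)

section \<open>Discrete unique continuation in one dimension\<close>

text \<open>A discrete eigenfunction, tested with the whole space without boundary conditions, is determined by
its value at the left end point.  Testing with \<open>Q\<close> itself shows that \<open>l\<close> is a quotient of
nonnegative numbers; afterwards \<open>rellich_cell\<close> propagates the zero from each cell to the next.\<close>

lemma discrete_unique_continuation:
  assumes p: "1 \<le> p" and x: "strict_mono_on {..M} x"
    and Q: "Q \<in> pw_space p M x" and Q0: "poly (Q 1) (of_real (x 0)) = 0"
    and eq: "\<And>R. R \<in> pw_space p M x \<Longrightarrow> stiff M x Q R = l * mass M x Q R"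
    and i: "i \<in> {1..M}"
  shows "Q i = 0"
proof (cases "mass M x Q Q = 0")
  case True
  then show ?thesis using mass_self_eq_0[OF x _ i] by blast
next
  case False
  obtain m where m: "m \<ge> 0" "mass M x Q Q = of_real m" using mass_self_nonneg by blast
  obtain s where s: "s \<ge> 0" "stiff M x Q Q = of_real s" unfolding stiff_def using mass_self_nonneg by blast
  define r where "r = s / m"
  have "m \<noteq> 0" "of_real s = l * of_real m" using False m s eq[OF Q] by auto
  then have l: "l = of_real r" and r: "r \<ge> 0"
    using m s by (auto simp: r_def field_simps)
  show ?thesis
    using i
  proof (induction i rule: less_induct)
    case (less i)
    have z: "Q j = 0" if "j < i" "1 \<le> j" for j using less that by auto
    have left0: "poly (Q i) (of_real (x (i - 1))) = 0"
    proof (cases "i = 1")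
      case True
      then show ?thesis using Q0 by simp
    next
      case False
      then have "i - 1 \<in> {1..<M}" using less.prems by auto
      then have "poly (Q (i - 1)) (of_real (x (i - 1))) = poly (Q i) (of_real (x (i - 1)))"
        using Q False less.prems unfolding pw_space_def by (auto dest: bspec[of _ _ "i - 1"])
      moreover have "Q (i - 1) = 0" using False less.prems by (intro z) auto
      ultimately show ?thesis by simp
    qed
    \<comment> \<open>The Rellich multiplier \<open>(x i - s) Q'\<close> vanishes at the right end of the cell; extending it by a
        constant to the left, where \<open>Q\<close> is already known to vanish, keeps the test function continuous.\<close>
    define q where "q = [:of_real (x i), -1:] * pderiv (Q i)"
    define R where "R j = (if j < i then [:poly q (of_real (x (i - 1))):] else if j = i then q else 0)" for j
    have "degree q \<le> p"
    proof (cases "pderiv (Q i) = 0")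
      case True
      then show ?thesis by (simp add: q_def)
    next
      case False
      then have "degree (Q i) \<noteq> 0" using pderiv_eq_0_iff by blast
      have "degree q \<le> degree [:complex_of_real (x i), -1:] + degree (pderiv (Q i))"
        unfolding q_def by (rule degree_mult_le)
      also have "\<dots> \<le> degree (Q i)" using \<open>degree (Q i) \<noteq> 0\<close> by (simp add: degree_pderiv)
      also have "degree (Q i) \<le> p" using Q less.prems unfolding pw_space_def by blast
      finally show ?thesis .
    qed
    moreover have "poly q (of_real (x i)) = 0" by (simp add: q_def)
    ultimately have R: "R \<in> pw_space p M x"
      unfolding pw_space_def
    proof (intro CollectI conjI ballI)
      fix j assume "j \<in> {1..<M}"
      consider "Suc j < i" | "Suc j = i" | "j = i" | "j > i" by linarith
      then show "poly (R j) (of_real (x j)) = poly (R (Suc j)) (of_real (x j))"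
        using \<open>poly q (of_real (x i)) = 0\<close> by cases (auto simp: R_def)
    qed (auto simp: R_def)
    have only: "(\<Sum>j=1..M. cell_ip (x (j - 1)) (x j) (A j) (B j)) = cell_ip (x (i - 1)) (x i) (A i) (B i)"
      if "\<And>j. j \<in> {1..M} \<Longrightarrow> j \<noteq> i \<Longrightarrow> A j = 0 \<or> B j = 0" for A B
    proof -
      have "(\<Sum>j=1..M. cell_ip (x (j - 1)) (x j) (A j) (B j)) =
          (\<Sum>j=1..M. if j = i then cell_ip (x (i - 1)) (x i) (A i) (B i) else 0)"
        using that by (intro sum.cong refl) (metis cell_ip_0_left cell_ip_0_right)
      then show ?thesis using less.prems by simp
    qed
    have *: "Q j = 0 \<or> R j = 0" if "j \<in> {1..M}" "j \<noteq> i" for j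
      using z[of j] that by (auto simp: R_def)
    have "stiff M x Q R = cell_ip (x (i - 1)) (x i) (pderiv (Q i)) (pderiv q)"
      unfolding stiff_def mass_def by (subst only) (use * in \<open>auto simp: R_def\<close>)
    moreover have "mass M x Q R = cell_ip (x (i - 1)) (x i) (Q i) q"
      unfolding mass_def by (subst only) (use * in \<open>auto simp: R_def\<close>)
    ultimately have "cell_ip (x (i - 1)) (x i) (pderiv (Q i)) (pderiv q) = of_real r * cell_ip (x (i - 1)) (x i) (Q i) q"
      using eq[OF R] l by simp
    then show "Q i = 0"
      unfolding q_def by (rule rellich_cell[OF partition_less[OF x less.prems] left0 r])
  qed
qed

section \<open>Nodal families\<close>

text \<open>The function encoded by a family of polynomials; at a breakpoint the cell to the left is used, which
is immaterial for members of \<^const>\<open>pw_space\<close>.\<close>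

definition pw_eval :: "(nat \<Rightarrow> real) \<Rightarrow> (nat \<Rightarrow> complex poly) \<Rightarrow> real \<Rightarrow> complex" where
  "pw_eval x Q s = poly (Q (LEAST i. 1 \<le> i \<and> s \<le> x i)) (of_real s)"

lemma pw_eval_cell:
  assumes x: "strict_mono_on {..M} x" and Q: "Q \<in> pw_space p M x"
    and i: "i \<in> {1..M}" and s: "s \<in> {x (i - 1)..x i}"
  shows "pw_eval x Q s = poly (Q i) (of_real s)"
proof -
  define j where "j = (LEAST i. 1 \<le> i \<and> s \<le> x i)"
  have j: "1 \<le> j" "s \<le> x j" "j \<le> i"
    using LeastI[of "\<lambda>i. 1 \<le> i \<and> s \<le> x i" i] Least_le[of "\<lambda>i. 1 \<le> i \<and> s \<le> x i" i] i s
    unfolding j_def by auto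
  have "poly (Q j) (of_real s) = poly (Q i) (of_real s)"
  proof (cases "j = i")
    case False
    have "j = i - 1"
    proof (rule ccontr)
      assume "j \<noteq> i - 1"
      then have "x j < x (i - 1)" using j False i by (intro strict_mono_onD[OF x]) auto
      then show False using j s by auto
    qed
    then have "s = x j" "Suc j = i" "j \<in> {1..<M}" using j False s i by auto
    then show ?thesis using Q by (auto simp: pw_space_def)
  qed simp
  then show ?thesis by (simp add: pw_eval_def j_def)
qed

lemma pw_eval_sum:
  "pw_eval x (\<lambda>i. \<Sum>c\<in>I. Polynomial.smult (\<alpha> c) (Q c i)) s = (\<Sum>c\<in>I. \<alpha> c * pw_eval x (Q c) s)"
  by (simp add: pw_eval_def poly_sum)

lemma continuous_on_pw_eval:
  assumes x: "strict_mono_on {..M} x" "1 \<le> M" and Q: "Q \<in> pw_space p M x"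
  shows "continuous_on {x 0..x M} (pw_eval x Q)"
proof -
  have "continuous_on {x (i - 1)..x i} (pw_eval x Q)" if i: "i \<in> {1..M}" for i
    by (rule continuous_on_eq[OF continuous_on_poly_of_real[of _ "Q i"]])
      (simp add: pw_eval_cell[OF x(1) Q i])
  then show ?thesis
    unfolding cover_interval[OF x] by (intro continuous_on_closed_Union) auto
qed

definition nodal_family :: "nat \<Rightarrow> nat \<Rightarrow> (nat \<Rightarrow> real) \<Rightarrow> (real \<Rightarrow> nat \<Rightarrow> complex poly) \<Rightarrow> bool" where
  "nodal_family p M x L \<longleftrightarrow> (\<forall>z. L z \<in> pw_space p M x \<and>
     (\<forall>s\<in>grid_nodes p M x. pw_eval x (L z) s = (if s = z then 1 else 0)))"

lemma grid_node_in_cell: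
  assumes "1 \<le> p" "strict_mono_on {..M} x" "s \<in> grid_nodes p M x"
  obtains i where "i \<in> {1..M}" "s \<in> {x (i - 1)..x i}"
  using assms node_in_cell[OF assms(2) _ assms(1)] unfolding grid_nodes_def by blast

lemma ex_nodal_family:
  assumes p: "1 \<le> p" and x: "strict_mono_on {..M} x" "1 \<le> M"
  obtains L where "nodal_family p M x L"
proof -
  have "\<exists>Q. Q \<in> pw_space p M x \<and>
     (\<forall>s\<in>grid_nodes p M x. pw_eval x Q s = (if s = z then 1 else 0))" for z
  proof (rule nodal_function_1d[OF p x, of z])
    fix f :: "real \<Rightarrow> complex"
    assume f: "\<And>i. i \<in> {1..M} \<Longrightarrow> \<exists>d. \<forall>s\<in>{x (i - 1)..x i}. f s = (\<Sum>a\<le>p. d a * of_real s ^ a)"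
      "\<And>s. s \<in> grid_nodes p M x \<Longrightarrow> f s = (if s = z then 1 else 0)"
    from f(1) obtain d where "\<forall>i\<in>{1..M}. \<forall>s\<in>{x (i - 1)..x i}. f s = (\<Sum>a\<le>p. d i a * of_real s ^ a)"
      using bchoice[of "{1..M}" "\<lambda>i d. \<forall>s\<in>{x (i - 1)..x i}. f s = (\<Sum>a\<le>p. d a * of_real s ^ a)"] by blast
    then have d: "\<And>i s. i \<in> {1..M} \<Longrightarrow> s \<in> {x (i - 1)..x i} \<Longrightarrow>
        f s = (\<Sum>a\<le>p. d i a * of_real s ^ a)" by blast
    define Q where "Q i = (\<Sum>a\<le>p. monom (d i a) a)" for i
    have Qf: "poly (Q i) (of_real s) = f s" if "i \<in> {1..M}" "s \<in> {x (i - 1)..x i}" for i s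
      using d[OF that] by (simp add: Q_def poly_sum poly_monom)
    have "degree (Q i) \<le> p" for i
      unfolding Q_def by (rule degree_sum_le) (auto intro: order_trans[OF degree_monom_le])
    moreover have "poly (Q i) (of_real (x i)) = poly (Q (Suc i)) (of_real (x i))" if "i \<in> {1..<M}" for i
      using Qf[of i "x i"] Qf[of "Suc i" "x i"] that partition_le[OF x(1), of "i - 1" i]
        partition_le[OF x(1), of i "Suc i"] by simp
    ultimately have Q: "Q \<in> pw_space p M x" by (simp add: pw_space_def)
    have "pw_eval x Q s = (if s = z then 1 else 0)" if s: "s \<in> grid_nodes p M x" for s
    proof -
      obtain i where i: "i \<in> {1..M}" "s \<in> {x (i - 1)..x i}" using grid_node_in_cell[OF p x(1) s] .
      show ?thesis unfolding pw_eval_cell[OF x(1) Q i] Qf[OF i] by (rule f(2)[OF s])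
    qed
    with Q show "\<exists>Q. Q \<in> pw_space p M x \<and>
     (\<forall>s\<in>grid_nodes p M x. pw_eval x Q s = (if s = z then 1 else 0))" by blast
  qed
  then have "\<exists>L. \<forall>z. L z \<in> pw_space p M x \<and>
     (\<forall>s\<in>grid_nodes p M x. pw_eval x (L z) s = (if s = z then 1 else 0))"
    by (intro choice allI)
  then show ?thesis using that unfolding nodal_family_def by blast
qed

text \<open>On each cell both sides are polynomials of degree at most \<open>p\<close> that agree at the \<open>p + 1\<close> nodes of that
cell.\<close>

lemma nodal_expansion:
  assumes p: "1 \<le> p" and x: "strict_mono_on {..M} x" and L: "nodal_family p M x L"
    and R: "R \<in> pw_space p M x" and i: "i \<in> {1..M}"
  shows "R i = (\<Sum>z\<in>grid_nodes p M x. Polynomial.smult (pw_eval x R z) (L z i))"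
proof (rule poly_eqI_degree)
  let ?A = "complex_of_real ` node p x i ` {..p}"
  let ?S = "\<lambda>i. \<Sum>z\<in>grid_nodes p M x. Polynomial.smult (pw_eval x R z) (L z i)"
  have S: "?S \<in> pw_space p M x"
    using L by (intro pw_space_sum finite_grid_nodes) (auto simp: nodal_family_def)
  have "card ?A = Suc p"
    using node_inj[OF x i p] by (simp add: card_image inj_on_def)
  then show "degree (R i) < card ?A" "degree (?S i) < card ?A"
    using R S i by (auto simp: pw_space_def less_Suc_eq_le)
  fix w assume "w \<in> ?A"
  then obtain l where l: "l \<le> p" "w = of_real (node p x i l)" by auto
  define s where "s = node p x i l"
  have cell: "s \<in> {x (i - 1)..x i}" unfolding s_def by (rule node_in_cell[OF x i p l(1)])
  have s: "s \<in> grid_nodes p M x" using i l by (auto simp: grid_nodes_def s_def)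
  have "pw_eval x ?S s = (\<Sum>z\<in>grid_nodes p M x. if z = s then pw_eval x R s else 0)"
    unfolding pw_eval_sum using L s by (intro sum.cong) (auto simp: nodal_family_def)
  also have "\<dots> = pw_eval x R s" using s by (simp add: finite_grid_nodes)
  finally show "poly (R i) w = poly (?S i) w"
    unfolding pw_eval_cell[OF x S i cell] pw_eval_cell[OF x R i cell] by (simp add: l(2) s_def)
qed

lemma nodal_independent:
  assumes p: "1 \<le> p" and x: "strict_mono_on {..M} x" and L: "nodal_family p M x L"
    and 0: "\<And>i. i \<in> {1..M} \<Longrightarrow> (\<Sum>z\<in>grid_nodes p M x. Polynomial.smult (c z) (L z i)) = 0"
    and s: "s \<in> grid_nodes p M x"
  shows "c s = 0"
proof -
  let ?S = "\<lambda>i. \<Sum>z\<in>grid_nodes p M x. Polynomial.smult (c z) (L z i)"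
  have S: "?S \<in> pw_space p M x"
    using L by (intro pw_space_sum finite_grid_nodes) (auto simp: nodal_family_def)
  obtain i where i: "i \<in> {1..M}" "s \<in> {x (i - 1)..x i}" using grid_node_in_cell[OF p x s] .
  have "pw_eval x ?S s = (\<Sum>z\<in>grid_nodes p M x. if z = s then c s else 0)"
    unfolding pw_eval_sum using L s by (intro sum.cong) (auto simp: nodal_family_def)
  also have "\<dots> = c s" using s by (simp add: finite_grid_nodes)
  finally show ?thesis unfolding pw_eval_cell[OF x S i] 0[OF i(1)] by simp
qed

text \<open>The Gram matrix of the nodal functions is positive definite: a combination of zero norm vanishes
identically, and its values at the nodes are the coefficients.\<close>

lemma nodal_gram_injective:
  assumes p: "1 \<le> p" and x: "strict_mono_on {..M} x" and L: "nodal_family p M x L"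
    and 0: "mass M x (\<lambda>i. \<Sum>z\<in>grid_nodes p M x. Polynomial.smult (c z) (L z i))
      (\<lambda>i. \<Sum>z\<in>grid_nodes p M x. Polynomial.smult (c z) (L z i)) = 0"
    and s: "s \<in> grid_nodes p M x"
  shows "c s = 0"
  using nodal_independent[OF p x L _ s] mass_self_eq_0[OF x 0] by blast

section \<open>The Helmholtz form on tensor products\<close>

lemma has_integral_partition:
  fixes f :: "real \<Rightarrow> complex" and x :: "nat \<Rightarrow> real" and M :: nat
  assumes x: "strict_mono_on {..M} x"
    and f: "\<And>i. i \<in> {1..M} \<Longrightarrow> (f has_integral g i) {x (i - 1)..x i}"
  shows "(f has_integral (\<Sum>i=1..M. g i)) {x 0..x M}"
  using assms
proof (induction M rule: nat_induct)
  case 0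
  then show ?case using has_integral_refl(2)[of f "x 0"] by simp
next
  case (Suc M)
  have x': "strict_mono_on {..M} x" using Suc.prems(1) by (auto simp: strict_mono_on_def)
  have "(f has_integral (\<Sum>i=1..M. g i)) {x 0..x M}"
    using Suc.prems(2) by (intro Suc.IH x') auto
  moreover have "(f has_integral g (Suc M)) {x M..x (Suc M)}"
    using Suc.prems(2)[of "Suc M"] by simp
  ultimately have "(f has_integral (\<Sum>i=1..M. g i) + g (Suc M)) {x 0..x (Suc M)}"
    by (rule has_integral_combine[rotated 2]) (auto intro!: partition_le[OF Suc.prems(1)])
  then show ?case by simp
qed

lemma negligible_fst_snd: "negligible {w :: real \<times> real. fst w = c}" "negligible {w :: real \<times> real. snd w = c}"
  using negligible_hyperplane[of "(1, 0) :: real \<times> real" c] negligible_hyperplane[of "(0, 1) :: real \<times> real" c]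
  by (simp_all add: inner_Pair_0 inner_prod_def zero_prod_def)

lemma cells_overlap:
  fixes x :: "nat \<Rightarrow> real" and M :: nat
  assumes x: "strict_mono_on {..M} x" and ij: "i \<in> {1..M}" "j \<in> {1..M}" "i \<noteq> j"
  shows "{x (i - 1)..x i} \<inter> {x (j - 1)..x j} \<subseteq> {x (min i j)}"
proof -
  have "x a \<le> x (b - 1)" if "a < b" "b \<le> M" for a b
    using that by (intro partition_le[OF x]) auto
  from this[of i j] this[of j i] ij show ?thesis by (auto simp: min_def)
qed

text \<open>Distinct closed cells overlap only in mesh lines, and the open rectangle differs from the union of
the cells only by its boundary.\<close>

lemma has_integral_mesh:
  fixes f :: "real \<times> real \<Rightarrow> complex"
  assumes x: "strict_mono_on {..M} x" "1 \<le> M" and y: "strict_mono_on {..N} y" "1 \<le> N"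
    and f: "\<And>i j. i \<in> {1..M} \<Longrightarrow> j \<in> {1..N} \<Longrightarrow> (f has_integral g i j) (mesh_cell x y i j)"
  shows "(f has_integral (\<Sum>i=1..M. \<Sum>j=1..N. g i j)) (rectangle M x N y)"
proof -
  have neg: "negligible (mesh_cell x y i j \<inter> mesh_cell x y i' j')"
    if "i \<in> {1..M}" "j \<in> {1..N}" "i' \<in> {1..M}" "j' \<in> {1..N}" "(i, j) \<noteq> (i', j')" for i j i' j'
  proof (cases "i = i'")
    case True
    then have "mesh_cell x y i j \<inter> mesh_cell x y i' j' \<subseteq> {w. snd w = y (min j j')}"
      using cells_overlap[OF y(1), of j j'] that by (auto simp: mesh_cell_def)
    then show ?thesis using negligible_fst_snd(2) negligible_subset by blast
  next
    case False
    then have "mesh_cell x y i j \<inter> mesh_cell x y i' j' \<subseteq> {w. fst w = x (min i i')}"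
      using cells_overlap[OF x(1), of i i'] that by (auto simp: mesh_cell_def)
    then show ?thesis using negligible_fst_snd(1) negligible_subset by blast
  qed
  have "(f has_integral (\<Sum>c\<in>{1..M} \<times> {1..N}. case c of (i, j) \<Rightarrow> g i j))
      (\<Union>c\<in>{1..M} \<times> {1..N}. case c of (i, j) \<Rightarrow> mesh_cell x y i j)"
    by (rule has_integral_UN) (use f neg in \<open>auto simp: pairwise_def\<close>)
  also have "(\<Union>c\<in>{1..M} \<times> {1..N}. case c of (i, j) \<Rightarrow> mesh_cell x y i j) = {x 0..x M} \<times> {y 0..y N}"
    unfolding cover_interval[OF x] cover_interval[OF y] mesh_cell_def by blast
  also have "\<dots> = cbox (x 0, y 0) (x M, y N)" by (simp add: cbox_Pair_eq)
  finally have "(f has_integral (\<Sum>c\<in>{1..M} \<times> {1..N}. case c of (i, j) \<Rightarrow> g i j)) (box (x 0, y 0) (x M, y N))"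
    by (simp add: has_integral_open_interval)
  moreover have "box (x 0, y 0) (x M, y N) = rectangle M x N y"
    by (auto simp: box_def rectangle_def Basis_prod_def)
  ultimately show ?thesis by (simp add: sum.cartesian_product)
qed

text \<open>Fubini for products of polynomials.  The integrand is prescribed only in the open cell because the
classical derivatives of finite element functions are unspecified on the mesh lines.\<close>

lemma has_integral_tensor_cell:
  assumes G: "\<And>s t. s \<in> {a<..<b} \<Longrightarrow> t \<in> {c<..<d} \<Longrightarrow> G (s, t) =
      (poly q (of_real s) * poly r (of_real t)) * cnj (poly q' (of_real s) * poly r' (of_real t))"
  shows "(G has_integral cell_ip a b q q' * cell_ip c d r r') ({a..b} \<times> {c..d})"
proof -
  define F where "F = (\<lambda>(s, t). (poly q (of_real s) * cnj (poly q' (of_real s))) *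
      (poly r (complex_of_real t) * cnj (poly r' (complex_of_real t))))"
  have cont: "continuous_on (cbox (a, c) (b, d)) F"
    unfolding F_def case_prod_unfold by (intro continuous_intros)
  have "integral (cbox (a, c) (b, d)) F = cell_ip a b q q' * cell_ip c d r r'"
    unfolding integral_prod_continuous[OF cont] by (simp add: F_def cell_ip_def)
  then have "(F has_integral cell_ip a b q q' * cell_ip c d r r') (cbox (a, c) (b, d))"
    using integrable_integral[OF integrable_continuous[OF cont]] by simp
  then have "(G has_integral cell_ip a b q q' * cell_ip c d r r') (cbox (a, c) (b, d))"
    by (rule has_integral_spike_interior) (auto simp: F_def G box_def Basis_prod_def)
  then show ?thesis by (simp add: cbox_Pair_eq)
qed

definition tensor_on :: "nat \<Rightarrow> (nat \<Rightarrow> real) \<Rightarrow> nat \<Rightarrow> (nat \<Rightarrow> real) \<Rightarrow> (real \<times> real \<Rightarrow> complex) \<Rightarrow>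
    (nat \<Rightarrow> complex poly) \<Rightarrow> (nat \<Rightarrow> complex poly) \<Rightarrow> bool" where
  "tensor_on M x N y u Q R \<longleftrightarrow> (\<forall>i\<in>{1..M}. \<forall>j\<in>{1..N}. \<forall>s\<in>{x (i - 1)..x i}. \<forall>t\<in>{y (j - 1)..y j}.
     u (s, t) = poly (Q i) (of_real s) * poly (R j) (of_real t))"

lemma tensor_onD:
  assumes "tensor_on M x N y u Q R" "i \<in> {1..M}" "j \<in> {1..N}"
    "s \<in> {x (i - 1)..x i}" "t \<in> {y (j - 1)..y j}"
  shows "u (s, t) = poly (Q i) (of_real s) * poly (R j) (of_real t)"
    and "u (s, t) = poly (R j) (of_real t) * poly (Q i) (of_real s)"
  using assms by (auto simp: tensor_on_def)

lemma dx_tensor: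
  assumes u: "tensor_on M x N y u Q R" and ij: "i \<in> {1..M}" "j \<in> {1..N}"
    and s: "s \<in> {x (i - 1)<..<x i}" and t: "t \<in> {y (j - 1)..y j}"
  shows "dx u (s, t) = poly (pderiv (Q i)) (of_real s) * poly (R j) (of_real t)"
proof -
  have "((\<lambda>r. poly (Q i) (of_real r) * poly (R j) (of_real t)) has_vector_derivative
      poly (pderiv (Q i)) (of_real s) * poly (R j) (of_real t)) (at s)"
    by (intro has_vector_derivative_mult_left poly_of_real_has_vector_derivative)
  then have "((\<lambda>r. u (r, t)) has_vector_derivative
      poly (pderiv (Q i)) (of_real s) * poly (R j) (of_real t)) (at s)"
    by (rule has_vector_derivative_transform_within_open[OF _ open_greaterThanLessThan s])
      (use u ij t in \<open>auto simp: tensor_on_def\<close>)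
  then show ?thesis by (simp add: dx_def vector_derivative_at)
qed

lemma dy_tensor:
  assumes u: "tensor_on M x N y u Q R" and ij: "i \<in> {1..M}" "j \<in> {1..N}"
    and s: "s \<in> {x (i - 1)..x i}" and t: "t \<in> {y (j - 1)<..<y j}"
  shows "dy u (s, t) = poly (Q i) (of_real s) * poly (pderiv (R j)) (of_real t)"
proof -
  have "((\<lambda>r. poly (Q i) (of_real s) * poly (R j) (of_real r)) has_vector_derivative
      poly (Q i) (of_real s) * poly (pderiv (R j)) (of_real t)) (at t)"
    by (intro has_vector_derivative_mult_right poly_of_real_has_vector_derivative)
  then have "((\<lambda>r. u (s, r)) has_vector_derivative
      poly (Q i) (of_real s) * poly (pderiv (R j)) (of_real t)) (at t)"
    by (rule has_vector_derivative_transform_within_open[OF _ open_greaterThanLessThan t])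
      (use u ij s in \<open>auto simp: tensor_on_def\<close>)
  then show ?thesis by (simp add: dy_def vector_derivative_at)
qed

lemma integral_tensor_edge:
  assumes x: "strict_mono_on {..M} x"
    and f: "\<And>i s. i \<in> {1..M} \<Longrightarrow> s \<in> {x (i - 1)..x i} \<Longrightarrow> f s =
      (poly (Q i) (of_real s) * \<beta>) * cnj (poly (Q' i) (of_real s) * \<beta>')"
  shows "integral {x 0..x M} f = mass M x Q Q' * (\<beta> * cnj \<beta>')"
proof -
  have "(f has_integral cell_ip (x (i - 1)) (x i) (Q i) (Q' i) * (\<beta> * cnj \<beta>')) {x (i - 1)..x i}"
    if i: "i \<in> {1..M}" for i
  proof -
    have "((\<lambda>s. poly (Q i) (of_real s) * cnj (poly (Q' i) (of_real s)) * (\<beta> * cnj \<beta>')) has_integral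
        cell_ip (x (i - 1)) (x i) (Q i) (Q' i) * (\<beta> * cnj \<beta>')) {x (i - 1)..x i}"
      unfolding cell_ip_def by (intro has_integral_mult_left integrable_integral cell_ip_integrable)
    then show ?thesis
      by (rule has_integral_eq[rotated]) (simp add: f[OF i])
  qed
  from has_integral_partition[OF x this] show ?thesis
    unfolding mass_def sum_distrib_right by (rule integral_unique)
qed

text \<open>Separation of variables: each integral over the rectangle factors cell by cell, and each side of the
boundary contributes the mass form along the side times the end point values across it.\<close>

lemma helmholtz_form_tensor:
  assumes x: "strict_mono_on {..M} x" "1 \<le> M" and y: "strict_mono_on {..N} y" "1 \<le> N"
    and u: "tensor_on M x N y u Q R" and v: "tensor_on M x N y v Q' R'"
  shows "helmholtz_form k M x N y u v =
    stiff M x Q Q' * mass N y R R' + mass M x Q Q' * stiff N y R R'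
    - of_real (k\<^sup>2) * (mass M x Q Q' * mass N y R R')
    - \<i> * of_real k * (mass M x Q Q' * trace_form N y R R' + trace_form M x Q Q' * mass N y R R')"
proof -
  let ?cx = "\<lambda>i. {x (i - 1)..x i}" and ?cy = "\<lambda>j. {y (j - 1)..y j}"
  define ix where "ix i f g = cell_ip (x (i - 1)) (x i) f g" for i f g
  define iy where "iy j f g = cell_ip (y (j - 1)) (y j) f g" for j f g
  have "((\<lambda>w. dx u w * cnj (dx v w) + dy u w * cnj (dy v w)) has_integral
      (\<Sum>i=1..M. \<Sum>j=1..N. ix i (pderiv (Q i)) (pderiv (Q' i)) * iy j (R j) (R' j) +
        ix i (Q i) (Q' i) * iy j (pderiv (R j)) (pderiv (R' j)))) (rectangle M x N y)"
    unfolding ix_def iy_def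
    by (intro has_integral_mesh x y, unfold mesh_cell_def,
        intro has_integral_add has_integral_tensor_cell)
      (simp_all only: dx_tensor[OF u] dx_tensor[OF v] dy_tensor[OF u] dy_tensor[OF v]
        greaterThanLessThan_iff atLeastAtMost_iff less_imp_le)
  then have grad: "integral (rectangle M x N y) (\<lambda>w. dx u w * cnj (dx v w) + dy u w * cnj (dy v w)) =
      stiff M x Q Q' * mass N y R R' + mass M x Q Q' * stiff N y R R'"
    unfolding stiff_def mass_def sum_product ix_def iy_def sum.distrib[symmetric]
    by (rule integral_unique)
  have "((\<lambda>w. u w * cnj (v w)) has_integral
      (\<Sum>i=1..M. \<Sum>j=1..N. ix i (Q i) (Q' i) * iy j (R j) (R' j))) (rectangle M x N y)"
    unfolding ix_def iy_def
    by (intro has_integral_mesh x y, unfold mesh_cell_def, intro has_integral_tensor_cell)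
      (use u v in \<open>auto simp: tensor_on_def\<close>)
  then have l2: "integral (rectangle M x N y) (\<lambda>w. u w * cnj (v w)) = mass M x Q Q' * mass N y R R'"
    unfolding mass_def sum_product ix_def iy_def by (rule integral_unique)
  have xy: "x (M - 1) \<le> x M" "y (N - 1) \<le> y N" "x 0 \<le> x 1" "y 0 \<le> y 1"
    using partition_le[OF x(1)] partition_le[OF y(1)] x(2) y(2) by auto
  have b1: "integral {x 0..x M} (\<lambda>s. u (s, y 0) * cnj (v (s, y 0))) =
      mass M x Q Q' * (poly (R 1) (of_real (y 0)) * cnj (poly (R' 1) (of_real (y 0))))"
    by (intro integral_tensor_edge x arg_cong2[where f = "\<lambda>a b. a * cnj b"]
        tensor_onD(1)[OF u] tensor_onD(1)[OF v])
      (use xy x(2) y(2) in auto)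
  have b2: "integral {x 0..x M} (\<lambda>s. u (s, y N) * cnj (v (s, y N))) =
      mass M x Q Q' * (poly (R N) (of_real (y N)) * cnj (poly (R' N) (of_real (y N))))"
    by (intro integral_tensor_edge x arg_cong2[where f = "\<lambda>a b. a * cnj b"]
        tensor_onD(1)[OF u] tensor_onD(1)[OF v])
      (use xy x(2) y(2) in auto)
  have b3: "integral {y 0..y N} (\<lambda>t. u (x 0, t) * cnj (v (x 0, t))) =
      mass N y R R' * (poly (Q 1) (of_real (x 0)) * cnj (poly (Q' 1) (of_real (x 0))))"
    by (intro integral_tensor_edge y arg_cong2[where f = "\<lambda>a b. a * cnj b"]
        tensor_onD(2)[OF u] tensor_onD(2)[OF v])
      (use xy x(2) y(2) in auto)
  have b4: "integral {y 0..y N} (\<lambda>t. u (x M, t) * cnj (v (x M, t))) =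
      mass N y R R' * (poly (Q M) (of_real (x M)) * cnj (poly (Q' M) (of_real (x M))))"
    by (intro integral_tensor_edge y arg_cong2[where f = "\<lambda>a b. a * cnj b"]
        tensor_onD(2)[OF u] tensor_onD(2)[OF v])
      (use xy x(2) y(2) in auto)
  show ?thesis
    unfolding helmholtz_form_def boundary_product_def grad l2 b1 b2 b3 b4 trace_form_def
    by (simp add: algebra_simps)
qed
text \<open>The product of two one-dimensional nodal functions belongs to the finite element space and has the
right nodal values, so uniqueness identifies it with the Lagrange basis function.\<close>

lemma lagrange_basis_tensor:
  assumes p: "1 \<le> p" and x: "strict_mono_on {..M} x" "1 \<le> M" and y: "strict_mono_on {..N} y" "1 \<le> N"
    and L: "nodal_family p M x L" and L': "nodal_family p N y L'"
  shows "tensor_on M x N y (lagrange_basis p M x N y (a, b)) (L a) (L' b)"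
proof -
  have Q: "L a \<in> pw_space p M x" and R: "L' b \<in> pw_space p N y"
    using L L' by (auto simp: nodal_family_def)
  define S where "S = {x 0..x M} \<times> {y 0..y N}"
  define u where "u w = (if w \<in> S then pw_eval x (L a) (fst w) * pw_eval y (L' b) (snd w) else 0)" for w
  have clo: "closure (rectangle M x N y) = S"
    by (simp add: S_def closure_rectangle[OF x y])
  have cells: "mesh_cell x y i j \<subseteq> S" if "i \<in> {1..M}" "j \<in> {1..N}" for i j
    using that unfolding S_def mesh_cell_def cover_interval[OF x] cover_interval[OF y] by blast
  have uv: "u (s, t) = poly (L a i) (of_real s) * poly (L' b j) (of_real t)"
    if "i \<in> {1..M}" "j \<in> {1..N}" "s \<in> {x (i - 1)..x i}" "t \<in> {y (j - 1)..y j}" for i j s t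
  proof -
    have "(s, t) \<in> S" using cells[OF that(1,2)] that(3,4) unfolding mesh_cell_def by blast
    then show ?thesis
      by (simp add: u_def pw_eval_cell[OF x(1) Q that(1,3)] pw_eval_cell[OF y(1) R that(2,4)])
  qed
  then have tens: "tensor_on M x N y u (L a) (L' b)" by (simp add: tensor_on_def)
  have "continuous_on S (\<lambda>w. pw_eval x (L a) (fst w) * pw_eval y (L' b) (snd w))"
    unfolding S_def
    by (intro continuous_on_mult continuous_on_compose2[OF continuous_on_pw_eval[OF x Q]]
        continuous_on_compose2[OF continuous_on_pw_eval[OF y R]] continuous_intros) auto
  then have cont: "continuous_on S u"
    by (rule continuous_on_eq) (simp add: u_def)
  have pol: "polynomial_on p (mesh_cell x y i j) u" if ij: "i \<in> {1..M}" "j \<in> {1..N}" for i j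
  proof -
    have deg: "degree (L a i) \<le> p" "degree (L' b j) \<le> p"
      using Q R ij by (auto simp: pw_space_def)
    have poly_sum_upto: "poly q w = (\<Sum>c\<le>p. coeff q c * w ^ c)" if "degree q \<le> p" for q :: "complex poly" and w
      unfolding poly_altdef using that by (intro sum.mono_neutral_left) (auto simp: coeff_eq_0)
    have "u (s, t) = (\<Sum>c\<le>p. \<Sum>d\<le>p. coeff (L a i) c * coeff (L' b j) d * of_real s ^ c * of_real t ^ d)"
      if "(s, t) \<in> mesh_cell x y i j" for s t
      using that uv[OF ij, of s t] poly_sum_upto[OF deg(1)] poly_sum_upto[OF deg(2)]
      by (simp add: mesh_cell_def sum_product algebra_simps)
    then show ?thesis
      unfolding polynomial_on_def
      by (intro exI[of _ "\<lambda>c d. coeff (L a i) c * coeff (L' b j) d"]) auto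
  qed
  have "u \<in> fe_space p M x N y"
    using cont pol by (auto simp: fe_space_def clo u_def)
  moreover have "u w = (if w = (a, b) then 1 else 0)" if w: "w \<in> fe_nodes p M x N y" for w
  proof -
    obtain s t where st: "w = (s, t)" "s \<in> grid_nodes p M x" "t \<in> grid_nodes p N y"
      using w by (auto simp: fe_nodes_def)
    obtain i where i: "i \<in> {1..M}" "s \<in> {x (i - 1)..x i}" using grid_node_in_cell[OF p x(1) st(2)] .
    obtain j where j: "j \<in> {1..N}" "t \<in> {y (j - 1)..y j}" using grid_node_in_cell[OF p y(1) st(3)] .
    have "u w = pw_eval x (L a) s * pw_eval y (L' b) t"
      unfolding st(1) uv[OF i(1) j(1) i(2) j(2)] pw_eval_cell[OF x(1) Q i] pw_eval_cell[OF y(1) R j] ..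
    then show ?thesis using L L' st by (auto simp: nodal_family_def)
  qed
  ultimately have "lagrange_basis p M x N y (a, b) = u"
    unfolding lagrange_basis_def by (intro the1_equality lagrange_basis_ex1[OF p x y]) auto
  then show ?thesis using tens by simp
qed

section \<open>Triangularization of matrix pencils\<close>

lemma invertible_if_trivial_kernel:
  fixes A :: "complex mat"
  assumes A: "A \<in> carrier_mat n n"
    and ker: "\<And>v. v \<in> carrier_vec n \<Longrightarrow> A *\<^sub>v v = 0\<^sub>v n \<Longrightarrow> v = 0\<^sub>v n"
  obtains B where "B \<in> carrier_mat n n" "B * A = 1\<^sub>m n" "A * B = 1\<^sub>m n"
proof -
  have "Determinant.det A \<noteq> 0"
    using ker unfolding det_0_iff_vec_prod_zero[OF A] by blast
  from det_non_zero_imp_unit[OF A this, unfolded Units_def, of "()"] that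
  show ?thesis by (auto simp: ring_mat_def)
qed

text \<open>Think of \<open>m i t\<close> and \<open>a i t\<close> as \<open>M(U\<^sub>i,t)\<close> and \<open>A(U\<^sub>i,t)\<close> with test functions \<open>t\<close>.  The hypothesis
\<open>inj\<close> lets one solve \<open>eq\<close> for \<open>a = G m\<close>, and \<open>eig\<close> excludes nontrivial combinations \<open>w\<close> of the
\<open>U\<^sub>i\<close> with \<open>A(w,t) = l M(w,t)\<close>.  Were \<open>G\<close> diagonalizable, the claim would follow eigenvector by
eigenvector; a triangular form \<open>G = P B Q\<close> is enough, as the last row of \<open>B\<close> is an eigenvalue
equation and becomes one for each earlier row once the later combinations are known to vanish.\<close>

lemma pencil_zero:
  fixes E K :: "nat \<Rightarrow> nat \<Rightarrow> complex" and a m :: "nat \<Rightarrow> 't \<Rightarrow> complex"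
  assumes inj: "\<And>c. (\<And>j. j < n \<Longrightarrow> (\<Sum>i<n. c i * E i j) = 0) \<Longrightarrow> \<forall>i<n. c i = 0"
    and eq: "\<And>j t. j < n \<Longrightarrow> t \<in> T \<Longrightarrow> (\<Sum>i<n. a i t * E i j) = (\<Sum>i<n. m i t * K i j)"
    and eig: "\<And>c l. (\<And>t. t \<in> T \<Longrightarrow> (\<Sum>i<n. c i * a i t) = l * (\<Sum>i<n. c i * m i t)) \<Longrightarrow>
      \<forall>t\<in>T. (\<Sum>i<n. c i * m i t) = 0"
    and i: "i < n" and t: "t \<in> T"
  shows "m i t = 0"
proof -
  define EM where "EM = Matrix.mat n n (\<lambda>(j, i). E i j)"
  define KM where "KM = Matrix.mat n n (\<lambda>(j, i). K i j)"
  define va where "va t = Matrix.vec n (\<lambda>i. a i t)" for t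
  define vm where "vm t = Matrix.vec n (\<lambda>i. m i t)" for t
  have carr: "EM \<in> carrier_mat n n" "KM \<in> carrier_mat n n" by (auto simp: EM_def KM_def)
  have vcarr: "va t \<in> carrier_vec n" "vm t \<in> carrier_vec n" for t by (auto simp: va_def vm_def)
  have "v = 0\<^sub>v n" if v: "v \<in> carrier_vec n" "EM *\<^sub>v v = 0\<^sub>v n" for v
  proof -
    have "(\<Sum>i<n. vec_index v i * E i j) = 0" if j: "j < n" for j
    proof -
      have "vec_index (EM *\<^sub>v v) j = 0" using v j by simp
      then show ?thesis using v j
        by (simp add: EM_def scalar_prod_def mult.commute atLeast0LessThan)
    qed
    from inj[OF this] show ?thesis using v by (intro eq_vecI) auto
  qed
  then obtain F where F: "F \<in> carrier_mat n n" "F * EM = 1\<^sub>m n"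
    using invertible_if_trivial_kernel[OF carr(1)] by blast
  define G where "G = F * KM"
  have G: "G \<in> carrier_mat n n" using F carr by (auto simp: G_def)
  have aG: "va t = G *\<^sub>v vm t" if "t \<in> T" for t
  proof -
    have "EM *\<^sub>v va t = KM *\<^sub>v vm t"
      using eq[OF _ that]
      by (intro eq_vecI) (auto simp: EM_def KM_def va_def vm_def scalar_prod_def mult.commute atLeast0LessThan)
    then have "F *\<^sub>v (EM *\<^sub>v va t) = F *\<^sub>v (KM *\<^sub>v vm t)" by simp
    then have "(F * EM) *\<^sub>v va t = G *\<^sub>v vm t"
      unfolding G_def assoc_mult_mat_vec[OF F(1) carr(1) vcarr(1)]
        assoc_mult_mat_vec[OF F(1) carr(2) vcarr(2)] .
    then show ?thesis using F(2) vcarr(1)[of t] by simp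
  qed
  obtain es where "char_poly G = (\<Prod>e\<leftarrow>es. [:- e, 1:])" using char_poly_factorized[OF G] by blast
  from schur_decomposition_exists[OF G this] obtain B where
    B: "B \<in> carrier_mat n n" "upper_triangular B" "similar_mat G B" by blast
  then obtain P Q where "similar_mat_wit G B P Q" unfolding similar_mat_def by blast
  from similar_mat_witD2[OF G this] have PQ: "P \<in> carrier_mat n n" "Q \<in> carrier_mat n n"
    "P * Q = 1\<^sub>m n" "Q * P = 1\<^sub>m n" "G = P * B * Q" by auto
  define c where "c t = Q *\<^sub>v vm t" for t
  have c: "c t \<in> carrier_vec n" for t using PQ vcarr by (auto simp: c_def)
  have Bc: "Q *\<^sub>v va t = B *\<^sub>v c t" if "t \<in> T" for t
  proof -
    have "Q *\<^sub>v va t = (Q * (P * B * Q)) *\<^sub>v vm t"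
      unfolding aG[OF that] PQ(5)[symmetric] assoc_mult_mat_vec[OF PQ(2) G vcarr(2)] ..
    also have "Q * (P * B * Q) = (Q * P) * (B * Q)"
      unfolding assoc_mult_mat[OF PQ(1) B(1) PQ(2)]
      by (rule assoc_mult_mat[symmetric, OF PQ(2,1) mult_carrier_mat[OF B(1) PQ(2)]])
    also have "\<dots> = B * Q" using PQ B by simp
    finally show ?thesis unfolding c_def assoc_mult_mat_vec[OF B(1) PQ(2) vcarr(2)] .
  qed
  have entry: "vec_index (Q *\<^sub>v Matrix.vec n f) i = (\<Sum>j<n. index_mat Q (i, j) * f j)" if "i < n" for f i
    using PQ that by (simp add: scalar_prod_def atLeast0LessThan)
  \<comment> \<open>Downward induction: below row \<open>i\<close> the transformed functionals already vanish, so the row reduces to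
      its diagonal entry.\<close>
  have c0: "\<forall>t\<in>T. vec_index (c t) i = 0" if "i < n" for i
    using that
  proof (induction "n - i" arbitrary: i rule: less_induct)
    case less
    have "vec_index (Q *\<^sub>v va t) i = index_mat B (i, i) * vec_index (c t) i" if t: "t \<in> T" for t
    proof -
      have "vec_index (Q *\<^sub>v va t) i = (\<Sum>j<n. index_mat B (i, j) * vec_index (c t) j)"
        unfolding Bc[OF t] using B(1) carrier_vecD[OF c[of t]] less.prems
        by (simp add: scalar_prod_def atLeast0LessThan)
      also have "\<dots> = (\<Sum>j<n. if j = i then index_mat B (i, i) * vec_index (c t) i else 0)"
      proof (intro sum.cong refl)
        fix j assume "j \<in> {..<n}"
        then consider "j < i" | "j = i" | "i < j" "j < n" by force
        then show "index_mat B (i, j) * vec_index (c t) j = (if j = i then index_mat B (i, i) * vec_index (c t) i else 0)"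
          using B less.prems less.hyps[of j] t by cases (auto simp: upper_triangular_def)
      qed
      finally show ?thesis using less.prems by simp
    qed
    from eig[of "\<lambda>j. index_mat Q (i, j)" "index_mat B (i, i)"] this
    show ?case unfolding c_def va_def vm_def entry[OF less.prems] by blast
  qed
  have "c t = 0\<^sub>v n" using c0 t c by (intro eq_vecI) auto
  moreover have "vm t = P *\<^sub>v c t"
    unfolding c_def assoc_mult_mat_vec[OF PQ(1,2) vcarr(2), symmetric] PQ(3)
    using vcarr(2)[of t] by simp
  ultimately have "vm t = 0\<^sub>v n" using PQ by auto
  then have "vec_index (vm t) i = 0" using i by simp
  then show ?thesis using i by (simp add: vm_def)
qed

lemma pencil_zero_finite:
  fixes E K :: "'i \<Rightarrow> 'i \<Rightarrow> complex" and a m :: "'i \<Rightarrow> 't \<Rightarrow> complex"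
  assumes I: "finite I"
    and inj: "\<And>c. (\<And>j. j \<in> I \<Longrightarrow> (\<Sum>i\<in>I. c i * E i j) = 0) \<Longrightarrow> \<forall>i\<in>I. c i = 0"
    and eq: "\<And>j t. j \<in> I \<Longrightarrow> t \<in> T \<Longrightarrow> (\<Sum>i\<in>I. a i t * E i j) = (\<Sum>i\<in>I. m i t * K i j)"
    and eig: "\<And>c l. (\<And>t. t \<in> T \<Longrightarrow> (\<Sum>i\<in>I. c i * a i t) = l * (\<Sum>i\<in>I. c i * m i t)) \<Longrightarrow>
      \<forall>t\<in>T. (\<Sum>i\<in>I. c i * m i t) = 0"
    and i: "i \<in> I" and t: "t \<in> T"
  shows "m i t = 0"
proof -
  obtain e where e: "bij_betw e {..<card I} I"
    using ex_bij_betw_nat_finite[OF I] by (auto simp: atLeast0LessThan)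
  have S: "(\<Sum>i\<in>I. f i) = (\<Sum>i<card I. f (e i))" for f :: "'i \<Rightarrow> complex"
    by (rule sum.reindex_bij_betw[OF e, symmetric])
  have eI: "e j \<in> I" if "j < card I" for j using e that by (auto simp: bij_betw_def)
  define g where "g = inv_into {..<card I} e"
  have g: "g (e j) = j" if "j < card I" for j
    unfolding g_def using e that by (auto simp: bij_betw_def)
  obtain j where j: "j < card I" "i = e j" using e i by (auto simp: bij_betw_def)
  have "m (e j) t = 0"
  proof (rule pencil_zero[where n = "card I" and T = T and E = "\<lambda>i j. E (e i) (e j)"
        and K = "\<lambda>i j. K (e i) (e j)" and a = "\<lambda>i. a (e i)" and m = "\<lambda>i. m (e i)" and i = j])
    fix c :: "nat \<Rightarrow> complex" assume c: "\<And>j. j < card I \<Longrightarrow> (\<Sum>i<card I. c i * E (e i) (e j)) = 0"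
    have "(\<Sum>i\<in>I. c (g i) * E i k) = 0" if "k \<in> I" for k
    proof -
      obtain j where "j < card I" "k = e j" using e \<open>k \<in> I\<close> by (auto simp: bij_betw_def)
      then show ?thesis unfolding S using c[of j] by (simp add: g)
    qed
    then have "\<forall>i\<in>I. c (g i) = 0" by (rule inj)
    then show "\<forall>i<card I. c i = 0" using eI g by metis
  next
    fix j t assume "j < card I" "t \<in> T"
    then show "(\<Sum>i<card I. a (e i) t * E (e i) (e j)) = (\<Sum>i<card I. m (e i) t * K (e i) (e j))"
      using eq[OF eI] unfolding S by blast
  next
    fix c :: "nat \<Rightarrow> complex" and l
    assume "\<And>t. t \<in> T \<Longrightarrow> (\<Sum>i<card I. c i * a (e i) t) = l * (\<Sum>i<card I. c i * m (e i) t)"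
    then show "\<forall>t\<in>T. (\<Sum>i<card I. c i * m (e i) t) = 0"
      using eig[of "\<lambda>i. c (g i)" l] unfolding S by (simp add: g)
  qed (use j t in auto)
  then show ?thesis by (simp add: j)
qed

section \<open>Injectivity of the system\<close>

text \<open>The heart of the argument, for the coefficients \<open>\<alpha>\<close> of \<open>u\<close> in the tensor product basis:
the energy identity gives \<open>u = 0\<close> on the boundary, and then separation of variables
and \<open>pencil_zero_finite\<close> reduce the claim to \<open>discrete_unique_continuation\<close>.\<close>

lemma tensor_system_injective:
  fixes \<alpha> :: "real \<Rightarrow> real \<Rightarrow> complex" and k :: real
  assumes p: "1 \<le> p" and x: "strict_mono_on {..M} x" "1 \<le> M" and y: "strict_mono_on {..N} y" "1 \<le> N"
    and L: "nodal_family p M x L" and L': "nodal_family p N y L'" and k: "k \<noteq> 0"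
    and eq: "\<And>a' b'. a' \<in> grid_nodes p M x \<Longrightarrow> b' \<in> grid_nodes p N y \<Longrightarrow>
      (\<Sum>a\<in>grid_nodes p M x. \<Sum>b\<in>grid_nodes p N y. \<alpha> a b *
        (stiff M x (L a) (L a') * mass N y (L' b) (L' b') + mass M x (L a) (L a') * stiff N y (L' b) (L' b')
        - of_real (k\<^sup>2) * (mass M x (L a) (L a') * mass N y (L' b) (L' b'))
        - \<i> * of_real k * (mass M x (L a) (L a') * trace_form N y (L' b) (L' b')
            + trace_form M x (L a) (L a') * mass N y (L' b) (L' b')))) = 0"
    and a: "a \<in> grid_nodes p M x" and b: "b \<in> grid_nodes p N y"
  shows "\<alpha> a b = 0"
proof -
  define X where "X = grid_nodes p M x"
  define Y where "Y = grid_nodes p N y"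
  have fin: "finite X" "finite Y" by (simp_all add: X_def Y_def finite_grid_nodes)
  define U where "U b i = (\<Sum>a\<in>X. Polynomial.smult (\<alpha> a b) (L a i))" for b i
  define My where "My b b' = mass N y (L' b) (L' b')" for b b'
  define Ay where "Ay b b' = stiff N y (L' b) (L' b')" for b b'
  define Ty where "Ty b b' = trace_form N y (L' b) (L' b')" for b b'
  have LV: "L a \<in> pw_space p M x" "L' b \<in> pw_space p N y" for a b
    using L L' by (auto simp: nodal_family_def)
  have U: "U b \<in> pw_space p M x" for b
    unfolding U_def by (intro pw_space_sum fin LV)
  define K where "K b b' = Ay b b' - of_real (k\<^sup>2) * My b b'" for b b'
  \<comment> \<open>Summing \<open>h c \<eta> b\<close> over \<open>b\<close> gives the form at \<open>u\<close>, tested with the product of \<open>\<eta>\<close> and \<open>L' c\<close>.\<close>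
  define h where "h b' \<eta> b = stiff M x (U b) \<eta> * My b b' + mass M x (U b) \<eta> * K b b'
    - \<i> * of_real k * (mass M x (U b) \<eta> * Ty b b' + trace_form M x (U b) \<eta> * My b b')" for b' \<eta> b
  have h_nodal: "(\<Sum>b\<in>Y. h b' (L a') b) = 0" if "a' \<in> X" "b' \<in> Y" for a' b'
  proof -
    have "(\<Sum>b\<in>Y. h b' (L a') b) = (\<Sum>b\<in>Y. \<Sum>a\<in>X. \<alpha> a b *
        (stiff M x (L a) (L a') * My b b' + mass M x (L a) (L a') * Ay b b'
        - of_real (k\<^sup>2) * (mass M x (L a) (L a') * My b b')
        - \<i> * of_real k * (mass M x (L a) (L a') * Ty b b' + trace_form M x (L a) (L a') * My b b')))"
      unfolding h_def U_def stiff_sum_left[OF fin(1)] mass_sum_left[OF fin(1)] trace_form_sum_left K_def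
        sum_distrib_left sum_distrib_right sum.distrib[symmetric] sum_subtractf[symmetric]
      by (intro sum.cong refl) (simp add: algebra_simps)
    also have "\<dots> = 0"
      using eq[folded X_def Y_def, OF that] unfolding My_def Ay_def Ty_def by (subst sum.swap)
    finally show ?thesis .
  qed
  have h0: "(\<Sum>b\<in>Y. h b' \<eta> b) = 0" if \<eta>: "\<eta> \<in> pw_space p M x" and b': "b' \<in> Y" for \<eta> b'
  proof -
    define \<beta> where "\<beta> a = pw_eval x \<eta> a" for a
    have e: "\<eta> i = (\<Sum>a\<in>X. Polynomial.smult (\<beta> a) (L a i))" if "i \<in> {1..M}" for i
      unfolding X_def \<beta>_def by (rule nodal_expansion[OF p x(1) L \<eta> that])
    have "stiff M x (U b) \<eta> = (\<Sum>a\<in>X. cnj (\<beta> a) * stiff M x (U b) (L a))"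
      "mass M x (U b) \<eta> = (\<Sum>a\<in>X. cnj (\<beta> a) * mass M x (U b) (L a))"
      "trace_form M x (U b) \<eta> = (\<Sum>a\<in>X. cnj (\<beta> a) * trace_form M x (U b) (L a))" for b
    proof -
      show "stiff M x (U b) \<eta> = (\<Sum>a\<in>X. cnj (\<beta> a) * stiff M x (U b) (L a))"
        unfolding stiff_sum_right[OF fin(1), symmetric] by (intro stiff_cong refl e)
      show "mass M x (U b) \<eta> = (\<Sum>a\<in>X. cnj (\<beta> a) * mass M x (U b) (L a))"
        unfolding mass_sum_right[OF fin(1), symmetric] by (intro mass_cong refl e)
      show "trace_form M x (U b) \<eta> = (\<Sum>a\<in>X. cnj (\<beta> a) * trace_form M x (U b) (L a))"
        unfolding trace_form_sum_right[symmetric] by (intro trace_form_cong x(2) refl e)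
    qed
    then have "h b' \<eta> b = (\<Sum>a\<in>X. cnj (\<beta> a) * h b' (L a) b)" for b
      unfolding h_def
      by (simp only: sum_distrib_left sum_distrib_right sum.distrib[symmetric] sum_subtractf[symmetric])
        (intro sum.cong refl, simp add: algebra_simps)
    then have "(\<Sum>b\<in>Y. h b' \<eta> b) = (\<Sum>b\<in>Y. \<Sum>a\<in>X. cnj (\<beta> a) * h b' (L a) b)" by simp
    also have "\<dots> = (\<Sum>a\<in>X. cnj (\<beta> a) * (\<Sum>b\<in>Y. h b' (L a) b))"
      unfolding sum_distrib_left by (rule sum.swap)
    finally show ?thesis using h_nodal[OF _ b'] by simp
  qed
  \<comment> \<open>The functions \<open>W \<phi>0\<close>, \<open>W \<phi>1\<close>, \<open>Z \<psi>0\<close>, \<open>Z \<psi>1\<close> are the restrictions of \<open>u\<close> to the four sides of the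
      rectangle, and the form at \<open>(u,u)\<close> is \<open>V - \<i> k B\<close> with \<open>V\<close> from the volume and \<open>B\<close> from the sides.\<close>
  define \<phi>0 where "\<phi>0 b = poly (L' b 1) (of_real (y 0))" for b
  define \<phi>1 where "\<phi>1 b = poly (L' b N) (of_real (y N))" for b
  define \<psi>0 where "\<psi>0 b = poly (U b 1) (of_real (x 0))" for b
  define \<psi>1 where "\<psi>1 b = poly (U b M) (of_real (x M))" for b
  define W where "W \<phi> i = (\<Sum>b\<in>Y. Polynomial.smult (\<phi> b) (U b i))" for \<phi> and i :: nat
  define Z where "Z \<psi> i = (\<Sum>b\<in>Y. Polynomial.smult (\<psi> b) (L' b i))" for \<psi> and i :: nat
  define V where "V = (\<Sum>b'\<in>Y. \<Sum>b\<in>Y. stiff M x (U b) (U b') * My b b' + mass M x (U b) (U b') * K b b')"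
  define B where "B = (\<Sum>b'\<in>Y. \<Sum>b\<in>Y. mass M x (U b) (U b') * Ty b b' + trace_form M x (U b) (U b') * My b b')"
  have VB: "V - \<i> * of_real k * B = 0"
  proof -
    have "V - \<i> * of_real k * B = (\<Sum>b'\<in>Y. \<Sum>b\<in>Y. h b' (U b') b)"
      unfolding V_def B_def h_def sum_distrib_left sum_subtractf ..
    then show ?thesis using h0[OF U] by simp
  qed
  have "cnj V = (\<Sum>b'\<in>Y. \<Sum>b\<in>Y. stiff M x (U b') (U b) * My b' b + mass M x (U b') (U b) * K b' b)"
    unfolding V_def cnj_sum
    by (intro sum.cong refl)
      (simp add: K_def My_def Ay_def stiff_cnj[symmetric] mass_cnj[symmetric])
  then have "cnj V = V" unfolding V_def by (subst sum.swap)
  then have ImV: "Im V = 0" by (metis Reals_cnj_iff complex_is_Real_iff)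
  have "B = mass M x (W \<phi>0) (W \<phi>0) + mass M x (W \<phi>1) (W \<phi>1) + mass N y (Z \<psi>0) (Z \<psi>0) + mass N y (Z \<psi>1) (Z \<psi>1)"
    unfolding B_def W_def Z_def mass_double_sum[OF fin(2)] sum.distrib[symmetric]
    by (intro sum.cong refl)
      (simp add: Ty_def My_def trace_form_def \<phi>0_def \<phi>1_def \<psi>0_def \<psi>1_def algebra_simps)
  moreover obtain r0 where r0: "r0 \<ge> 0" "mass M x (W \<phi>0) (W \<phi>0) = of_real r0" using mass_self_nonneg by blast
  moreover obtain r1 where r1: "r1 \<ge> 0" "mass M x (W \<phi>1) (W \<phi>1) = of_real r1" using mass_self_nonneg by blast
  moreover obtain r2 where r2: "r2 \<ge> 0" "mass N y (Z \<psi>0) (Z \<psi>0) = of_real r2" using mass_self_nonneg by blast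
  moreover obtain r3 where r3: "r3 \<ge> 0" "mass N y (Z \<psi>1) (Z \<psi>1) = of_real r3" using mass_self_nonneg by blast
  ultimately have B: "B = of_real (r0 + r1 + r2 + r3)" by simp
  have "Im (V - \<i> * of_real k * B) = - (k * (r0 + r1 + r2 + r3))" unfolding B using ImV by simp
  then have "r0 + r1 + r2 + r3 = 0" using VB k by simp
  then have "r0 = 0" "r1 = 0" "r2 = 0" "r3 = 0" using r0(1) r1(1) r2(1) r3(1) by auto
  then have bd: "mass M x (W \<phi>0) (W \<phi>0) = 0" "mass M x (W \<phi>1) (W \<phi>1) = 0"
    "mass N y (Z \<psi>0) (Z \<psi>0) = 0" "mass N y (Z \<psi>1) (Z \<psi>1) = 0"
    using r0 r1 r2 r3 by auto
  have \<psi>: "\<psi>0 b = 0" "\<psi>1 b = 0" if "b \<in> Y" for b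
    using nodal_gram_injective[OF p y(1) L' _ that[unfolded Y_def]] bd(3,4)
    unfolding Z_def Y_def by blast+
  have W: "mass M x (W \<phi>0) \<eta> = 0" "mass M x (W \<phi>1) \<eta> = 0" for \<eta>
    using mass_self_eq_0[OF x(1)] bd(1,2) by (auto intro!: mass_0_left)
  \<comment> \<open>With \<open>u = 0\<close> on the boundary, the boundary part drops out for every test function.\<close>
  have pencil: "(\<Sum>b\<in>Y. stiff M x (U b) \<eta> * My b b') = (\<Sum>b\<in>Y. mass M x (U b) \<eta> * - K b b')"
    if b': "b' \<in> Y" and \<eta>: "\<eta> \<in> pw_space p M x" for b' \<eta>
  proof -
    have tr: "trace_form M x (U b) \<eta> = 0" if "b \<in> Y" for b
      using \<psi>[OF that] by (simp add: trace_form_def \<psi>0_def \<psi>1_def)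
    have "(\<Sum>b\<in>Y. mass M x (U b) \<eta> * Ty b b') =
        mass M x (W \<phi>0) \<eta> * cnj (\<phi>0 b') + mass M x (W \<phi>1) \<eta> * cnj (\<phi>1 b')"
      unfolding W_def mass_sum_left[OF fin(2)] sum_distrib_right sum.distrib[symmetric]
      by (intro sum.cong refl) (simp add: Ty_def trace_form_def \<phi>0_def \<phi>1_def algebra_simps)
    then have Ty: "(\<Sum>b\<in>Y. mass M x (U b) \<eta> * Ty b b') = 0" using W by simp
    have "0 = (\<Sum>b\<in>Y. h b' \<eta> b)" using h0[OF \<eta> b'] by simp
    also have "\<dots> = (\<Sum>b\<in>Y. stiff M x (U b) \<eta> * My b b' + mass M x (U b) \<eta> * K b b'
        - \<i> * of_real k * (mass M x (U b) \<eta> * Ty b b'))"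
      by (intro sum.cong refl) (simp add: h_def tr)
    also have "\<dots> = (\<Sum>b\<in>Y. stiff M x (U b) \<eta> * My b b') + (\<Sum>b\<in>Y. mass M x (U b) \<eta> * K b b')"
      unfolding sum_subtractf sum.distrib sum_distrib_left[symmetric] Ty by simp
    finally show ?thesis by (simp add: sum_negf eq_neg_iff_add_eq_0)
  qed
  have massU: "mass M x (U b) \<eta> = 0" if "b \<in> Y" "\<eta> \<in> pw_space p M x" for b \<eta>
  proof (rule pencil_zero_finite[where I = Y and T = "pw_space p M x" and E = My and K = "\<lambda>b b'. - K b b'"
        and a = "\<lambda>b. stiff M x (U b)" and m = "\<lambda>b. mass M x (U b)"])
    fix c :: "real \<Rightarrow> complex" assume c: "\<And>j. j \<in> Y \<Longrightarrow> (\<Sum>i\<in>Y. c i * My i j) = 0"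
    have "mass N y (Z c) (Z c) = (\<Sum>b'\<in>Y. cnj (c b') * (\<Sum>b\<in>Y. c b * My b b'))"
      unfolding Z_def mass_double_sum[OF fin(2)] sum_distrib_left
      by (intro sum.cong refl) (simp add: My_def)
    also have "\<dots> = 0" using c by simp
    finally show "\<forall>i\<in>Y. c i = 0"
      unfolding Z_def Y_def using nodal_gram_injective[OF p y(1) L'] by blast
  next
    fix c l
    assume l: "\<And>\<eta>. \<eta> \<in> pw_space p M x \<Longrightarrow>
      (\<Sum>b\<in>Y. c b * stiff M x (U b) \<eta>) = l * (\<Sum>b\<in>Y. c b * mass M x (U b) \<eta>)"
    have "W c i = 0" if "i \<in> {1..M}" for i
    proof (rule discrete_unique_continuation[OF p x(1) _ _ _ that])
      show "W c \<in> pw_space p M x" unfolding W_def by (intro pw_space_sum fin U)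
      show "poly (W c 1) (of_real (x 0)) = 0"
        using \<psi>(1) by (simp add: W_def poly_sum \<psi>0_def)
      show "stiff M x (W c) \<eta> = l * mass M x (W c) \<eta>" if "\<eta> \<in> pw_space p M x" for \<eta>
        unfolding W_def stiff_sum_left[OF fin(2)] mass_sum_left[OF fin(2)] by (rule l[OF that])
    qed
    then have "mass M x (W c) \<eta> = 0" for \<eta> by (rule mass_0_left)
    then show "\<forall>\<eta>\<in>pw_space p M x. (\<Sum>b\<in>Y. c b * mass M x (U b) \<eta>) = 0"
      unfolding W_def mass_sum_left[OF fin(2)] by blast
  qed (use pencil that fin in auto)
  have "mass M x (U b) (U b) = 0" using massU U b by (simp add: Y_def)
  then show ?thesis
    unfolding U_def X_def by (rule nodal_gram_injective[OF p x(1) L _ a, where c = "\<lambda>a. \<alpha> a b"])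
qed

theorem theorem3p12:
  fixes x y :: "nat \<Rightarrow> real" and M N p :: nat and k :: real and z :: "nat \<Rightarrow> real \<times> real"
  assumes "1 \<le> M" and "strict_mono_on {..M} x"
    and "1 \<le> N" and "strict_mono_on {..N} y"
    and "p \<in> {1, 2, 3}"
    and "k \<noteq> 0"
    and "bij_betw z {..<card (fe_nodes p M x N y)} (fe_nodes p M x N y)"
  shows "invertible_mat (system_matrix k p M x N y z)"
proof -
  define n where "n = card (fe_nodes p M x N y)"
  define A where "A = system_matrix k p M x N y z"
  have p: "1 \<le> p" using assms(5) by auto
  note x = assms(2,1) and y = assms(4,3)
  have z: "bij_betw z {..<n} (fe_nodes p M x N y)" using assms(7) by (simp add: n_def)
  have A: "A \<in> carrier_mat n n" by (simp add: A_def system_matrix_def n_def Let_def)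
  obtain L where L: "nodal_family p M x L" using ex_nodal_family[OF p x] .
  obtain L' where L': "nodal_family p N y L'" using ex_nodal_family[OF p y] .
  have "v = 0\<^sub>v n" if v: "v \<in> carrier_vec n" "A *\<^sub>v v = 0\<^sub>v n" for v
  proof -
    define g where "g = inv_into {..<n} z"
    have g: "g (z c) = c" if "c < n" for c
      unfolding g_def using z that by (auto simp: bij_betw_def)
    define \<alpha> where "\<alpha> a b = vec_index v (g (a, b))" for a b
    let ?b = "lagrange_basis p M x N y"
    have sys: "(\<Sum>a\<in>grid_nodes p M x. \<Sum>b\<in>grid_nodes p N y.
        \<alpha> a b * helmholtz_form k M x N y (?b (a, b)) (?b w)) = 0" if w: "w \<in> fe_nodes p M x N y" for w
    proof -
      obtain r where r: "r < n" "w = z r" using z w by (auto simp: bij_betw_def)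
      have "(\<Sum>a\<in>grid_nodes p M x. \<Sum>b\<in>grid_nodes p N y.
          \<alpha> a b * helmholtz_form k M x N y (?b (a, b)) (?b w)) =
          (\<Sum>q\<in>fe_nodes p M x N y. vec_index v (g q) * helmholtz_form k M x N y (?b q) (?b w))"
        unfolding fe_nodes_def sum.cartesian_product \<alpha>_def by (intro sum.cong) auto
      also have "\<dots> = (\<Sum>c<n. vec_index v (g (z c)) * helmholtz_form k M x N y (?b (z c)) (?b w))"
        by (rule sum.reindex_bij_betw[OF z, symmetric])
      also have "\<dots> = vec_index (A *\<^sub>v v) r"
        using r carrier_vecD[OF v(1)]
        by (auto simp: A_def system_matrix_def n_def[symmetric] Let_def scalar_prod_def atLeast0LessThan g
            intro!: sum.cong)
      also have "\<dots> = 0" using v(2) r by simp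
      finally show ?thesis .
    qed
    have \<alpha>: "\<alpha> a b = 0" if "a \<in> grid_nodes p M x" "b \<in> grid_nodes p N y" for a b
    proof (rule tensor_system_injective[OF p x y L L' assms(6) _ that])
      fix a' b' assume "a' \<in> grid_nodes p M x" "b' \<in> grid_nodes p N y"
      then have "(a', b') \<in> fe_nodes p M x N y" by (simp add: fe_nodes_def)
      from sys[OF this] show "(\<Sum>a\<in>grid_nodes p M x. \<Sum>b\<in>grid_nodes p N y. \<alpha> a b *
        (stiff M x (L a) (L a') * mass N y (L' b) (L' b') + mass M x (L a) (L a') * stiff N y (L' b) (L' b')
        - of_real (k\<^sup>2) * (mass M x (L a) (L a') * mass N y (L' b) (L' b'))
        - \<i> * of_real k * (mass M x (L a) (L a') * trace_form N y (L' b) (L' b')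
            + trace_form M x (L a) (L a') * mass N y (L' b) (L' b')))) = 0"
        unfolding helmholtz_form_tensor[OF x y lagrange_basis_tensor[OF p x y L L'] lagrange_basis_tensor[OF p x y L L']] .
    qed
    show ?thesis
    proof (rule eq_vecI)
      fix c assume "c < dim_vec (0\<^sub>v n :: complex vec)"
      then have c: "c < n" by simp
      then have "z c \<in> fe_nodes p M x N y" using z by (auto simp: bij_betw_def)
      then obtain a b where ab: "z c = (a, b)" "a \<in> grid_nodes p M x" "b \<in> grid_nodes p N y"
        by (auto simp: fe_nodes_def)
      show "vec_index v c = vec_index (0\<^sub>v n) c"
        using \<alpha>[OF ab(2,3)] g[OF c] c by (simp add: \<alpha>_def ab(1)[symmetric])
    qed (use v in auto)
  qed
  from invertible_if_trivial_kernel[OF A this] obtain B where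
    "B \<in> carrier_mat n n" "B * A = 1\<^sub>m n" "A * B = 1\<^sub>m n" by blast
  then show ?thesis
    using A unfolding A_def[symmetric] invertible_mat_def inverts_mat_def by auto
qed

end
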